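(* (i) For every prime $p$ with $5\le p\le 599$ and $p\notin\{11,83,103,163,397\}$, the statement $\mathrm{ML}(p)$ is false. (ii) For $p\in\{83,397\}$ the statement $\mathrm{ML}(p)$ is true; more precisely, with $Q_{83}=287$ and $Q_{397}=132$, for every $n\in\mathbb Z$, $$ \nu_p(T(n))=\begin{cases}\nu_p(n-a)+1, & \text{if } n\equiv a\pmod{Q_p} \text{ for some } a\in\{0,-1,-4,-17\},\\ 0,&\text{otherwise}.\end{cases} $$
   Context: $T:\mathbb Z\to\mathbb Z$ is the Tribonacci sequence: $T(0)=0$, $T(1)=T(2)=1$, $T(n+3)=T(n+2)+T(n+1)+T(n)$ for all $n\in\mathbb Z$. $\nu_p$ is the $p$-adic valuation on $\mathbb Q$, $\nu_p(0)=+\infty$. For a prime $p$, $\mathrm{ML}(p)$ is the statement: there exists a positive integer $Q$ such that for every $i\in\{0,1,\dots,Q-1\}$ one of the following holds: (C) there is $\kappa_i\in\mathbb Z_{\ge0}$ such that $\nu_p(T(n))=\kappa_i$ for all but finitely many $n\in\mathbb Z$ with $n\equiv i\pmod Q$; or (L) there exist $a_i\in\mathbb Z$, $\kappa_i\in\mathbb Z$, $\mu_i\in\mathbb Z_{>0}$ with $\nu_p(a_i-i)\ge\nu_p(Q)$ such that $\nu_p(T(n))=\kappa_i+\mu_i\nu_p(n-a_i)$ for all but finitely many $n\in\mathbb Z$ with $n\equiv i\pmod Q$. *)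

theory Defs
  imports Complex_Main "HOL-Computational_Algebra.Primes" "HOL-Library.Extended_Real"
begin

fun trib_pos :: "nat \<Rightarrow> int" where
  "trib_pos 0 = 0"
| "trib_pos (Suc 0) = 1"
| "trib_pos (Suc (Suc 0)) = 1"
| "trib_pos (Suc (Suc (Suc k))) = trib_pos (Suc (Suc k)) + trib_pos (Suc k) + trib_pos k"

fun trib_neg :: "nat \<Rightarrow> int" where
  "trib_neg 0 = 0"
| "trib_neg (Suc 0) = 0"
| "trib_neg (Suc (Suc 0)) = 1"
| "trib_neg (Suc (Suc (Suc k))) = trib_neg k - trib_neg (Suc k) - trib_neg (Suc (Suc k))"

definition T :: "int \<Rightarrow> int" where
  "T n = (if n \<ge> 0 then trib_pos (nat n) else trib_neg (nat (- n)))"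

definition nu :: "int \<Rightarrow> int \<Rightarrow> ereal" where
  "nu p x = (if x = 0 then \<infinity> else ereal (real (multiplicity p x)))"

definition MLstmt :: "int \<Rightarrow> bool" where
  "MLstmt p \<longleftrightarrow> (\<exists>Q::int. Q > 0 \<and> (\<forall>i\<in>{0..<Q}.
      (\<exists>\<kappa>::nat. finite {n::int. n mod Q = i \<and> nu p (T n) \<noteq> ereal (real \<kappa>)})
    \<or> (\<exists>(a::int) (\<kappa>::int) (\<mu>::int). \<mu> > 0 \<and> nu p (a - i) \<ge> nu p Q \<and>
         finite {n::int. n mod Q = i \<and>
                  nu p (T n) \<noteq> ereal (real_of_int \<kappa>) + ereal (real_of_int \<mu>) * nu p (n - a)})))"

lemma T_0: "T 0 = 0" and T_1: "T 1 = 1" and T_2: "T 2 = 1"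
  by (simp_all add: T_def numeral_2_eq_2 nat_numeral)

lemma T_rec: "T (n + 3) = T (n + 2) + T (n + 1) + T n"
proof -
  consider "n \<ge> 0" | "n = -1" | "n = -2" | "n = -3" | "n \<le> -4" by linarith
  then show ?thesis
  proof cases
    case 1
    then obtain k where k: "n = int k" by (metis nonneg_int_cases)
    have "nat (int k + 3) = Suc (Suc (Suc k))" "nat (int k + 2) = Suc (Suc k)"
         "nat (int k + 1) = Suc k" by auto
    then show ?thesis using k by (simp add: T_def)
  next
    case 2 then show ?thesis by (simp add: T_def numeral_2_eq_2 numeral_3_eq_3)
  next
    case 3 then show ?thesis by (simp add: T_def numeral_2_eq_2 numeral_3_eq_3)
  next
    case 4 then show ?thesis by (simp add: T_def numeral_2_eq_2 numeral_3_eq_3)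
  next
    case 5
    define j where "j = nat (- n) - 3"
    have a: "nat (- n) = Suc (Suc (Suc j))" and b: "nat (- (n+1)) = Suc (Suc j)"
      and c: "nat (- (n+2)) = Suc j" and d: "nat (- (n+3)) = j" and "j \<ge> 1"
      using 5 by (auto simp: j_def)
    then show ?thesis using 5 unfolding T_def
      by (simp add: a b c d del: minus_add_distrib)
  qed
qed

end

theory Submission
  imports Defs "Jordan_Normal_Form.Char_Poly"
begin

text \<open>
  If \<open>p\<^sup>2\<close> divides \<open>T(m)\<close> but not \<open>T(m + N)\<close>, where \<open>N\<close> is a period modulo \<open>p\<close>, Hensel's lemma gives a
  \<open>p\<close>-adic zero \<open>\<zeta> \<equiv> m (mod p)\<close> of \<open>T\<close> on the class of \<open>m\<close> modulo \<open>N\<close>. Along this class the valuation is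
  unbounded near \<open>\<zeta>\<close>, so \<open>ML(p)\<close> forces \<open>\<zeta>\<close> to be an integer \<open>a\<close>.

  Such an \<open>a\<close> satisfies \<open>T(a) = 0\<close>. Let \<open>u\<^sub>i = c\<^sub>i \<lambda>\<^sub>i\<^bsup>a\<^esup>\<close> be the Binet terms at \<open>a\<close>, with \<open>\<lambda>\<^sub>1\<close> real and
  \<open>\<lambda>\<^sub>2, \<lambda>\<^sub>3\<close> complex conjugate. Approximating \<open>a\<close> \<open>p\<close>-adically, the product of all
  \<open>z\<^sub>1 u\<^sub>1 + z\<^sub>2 u\<^sub>2 + z\<^sub>3 u\<^sub>3\<close> with \<open>z\<^sub>i\<^bsup>N\<^esup> = 1\<close> is an algebraic integer (up to scaling) divisible by every power
  of \<open>p\<close>, so one factor vanishes. Complex conjugation then gives \<open>z\<^sub>1\<^sup>2 = z\<^sub>2 z\<^sub>3\<close>, that is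
  \<open>u\<^sub>1 + z u\<^sub>2 + u\<^sub>3 / z = 0\<close>. The existence of such a root of unity \<open>z\<close> is an identity in \<open>\<rat>(\<lambda>\<^sub>1)\<close>, so it
  also holds with \<open>\<lambda>\<^sub>2\<close> in the role of \<open>\<lambda>\<^sub>1\<close>; applying complex conjugation again gives \<open>z\<^sup>3 = 1\<close>. The case
  \<open>z \<noteq> 1\<close> would give \<open>(\<Sum>u\<^sub>i)\<^sup>2 = 3 \<Sum>u\<^sub>i u\<^sub>j\<close>, which fails modulo 7.

  For \<open>p = 83\<close> and \<open>p = 397\<close> all zeros modulo \<open>p\<close> lie in the classes of \<open>0, -1, -4, -17\<close> and are simple; this
  gives the valuation formula, and the formula for 397 shows that \<open>T\<close> has no other integer zeros.
\<close>

section \<open>Algebraic integers\<close>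

definition int_span :: "complex set \<Rightarrow> complex set" where
  "int_span B = {x. \<exists>c :: complex \<Rightarrow> int. x = (\<Sum>b\<in>B. of_int (c b) * b)}"

lemma int_span_add: "x \<in> int_span B \<Longrightarrow> y \<in> int_span B \<Longrightarrow> x + y \<in> int_span B"
proof -
  assume "x \<in> int_span B" "y \<in> int_span B"
  then obtain c d :: "complex \<Rightarrow> int"
    where "x = (\<Sum>b\<in>B. of_int (c b) * b)" "y = (\<Sum>b\<in>B. of_int (d b) * b)"
    by (auto simp: int_span_def)
  then have "x + y = (\<Sum>b\<in>B. of_int (c b + d b) * b)"
    by (simp add: sum.distrib algebra_simps)
  then show ?thesis
    unfolding int_span_def by (intro CollectI exI[of _ "\<lambda>b. c b + d b"])
qed

lemma int_span_of_int_mult: "x \<in> int_span B \<Longrightarrow> of_int k * x \<in> int_span B"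
proof -
  assume "x \<in> int_span B"
  then obtain c :: "complex \<Rightarrow> int" where "x = (\<Sum>b\<in>B. of_int (c b) * b)"
    by (auto simp: int_span_def)
  then have "of_int k * x = (\<Sum>b\<in>B. of_int (k * c b) * b)"
    by (simp add: sum_distrib_left algebra_simps)
  then show ?thesis
    unfolding int_span_def by (intro CollectI exI[of _ "\<lambda>b. k * c b"])
qed

lemma int_span_0: "0 \<in> int_span B"
  unfolding int_span_def by (intro CollectI exI[of _ "\<lambda>_. 0"]) simp

lemma int_span_sum: "(\<And>i. i \<in> I \<Longrightarrow> f i \<in> int_span B) \<Longrightarrow> sum f I \<in> int_span B"
  by (induction I rule: infinite_finite_induct) (auto simp: int_span_0 int_span_add)

lemma int_span_base: "finite B \<Longrightarrow> b \<in> B \<Longrightarrow> b \<in> int_span B"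
  unfolding int_span_def
  by (intro CollectI exI[of _ "\<lambda>b'. if b' = b then 1 else 0"])
     (simp add: if_distrib[of of_int] if_distrib[of "\<lambda>x. x * _"] cong: if_cong)

lemma int_span_closed:
  assumes "\<And>b. b \<in> B \<Longrightarrow> x * b \<in> int_span B" "y \<in> int_span B"
  shows "x * y \<in> int_span B"
proof -
  obtain c :: "complex \<Rightarrow> int" where "y = (\<Sum>b\<in>B. of_int (c b) * b)"
    using assms(2) by (auto simp: int_span_def)
  then have "x * y = (\<Sum>b\<in>B. of_int (c b) * (x * b))"
    by (simp add: sum_distrib_left algebra_simps)
  also have "\<dots> \<in> int_span B"
    by (intro int_span_sum int_span_of_int_mult assms(1))
  finally show ?thesis .
qed

text \<open>Determinant trick: the vector of generators is an eigenvector, with eigenvalue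
  \<open>x\<close>, of an integer matrix, so \<open>x\<close> is a root of a monic characteristic
  polynomial. The element \<open>b0\<close> keeps the vector nonzero.\<close>

lemma algebraic_int_if_stabilizes:
  assumes "finite B" and stable: "\<And>b. b \<in> B \<Longrightarrow> x * b \<in> int_span B" and "b0 \<in> B" "b0 \<noteq> 0"
  shows "algebraic_int (x :: complex)"
proof -
  obtain f :: "nat \<Rightarrow> complex" and n where f: "bij_betw f {..<n} B"
    using \<open>finite B\<close> by (metis bij_betw_from_nat_into_finite)
  obtain k where k: "k < n" "f k = b0"
    using f \<open>b0 \<in> B\<close> by (metis bij_betw_def imageE lessThan_iff)
  have "\<forall>b\<in>B. \<exists>c :: complex \<Rightarrow> int. x * b = (\<Sum>b'\<in>B. of_int (c b') * b')"
    using stable by (auto simp: int_span_def)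
  then obtain c :: "complex \<Rightarrow> complex \<Rightarrow> int"
    where c: "\<And>b. b \<in> B \<Longrightarrow> x * b = (\<Sum>b'\<in>B. of_int (c b b') * b')"
    by metis
  define A :: "int mat" where "A = mat n n (\<lambda>(i, j). c (f i) (f j))"
  define A' :: "complex mat" where "A' = map_mat of_int A"
  define v :: "complex vec" where "v = vec n f"
  have A: "A \<in> carrier_mat n n" and A': "A' \<in> carrier_mat n n"
    by (simp_all add: A_def A'_def)
  have "A' *\<^sub>v v = x \<cdot>\<^sub>v v"
  proof (rule eq_vecI)
    fix i assume "i < dim_vec (x \<cdot>\<^sub>v v)"
    then have i: "i < n" by (simp add: v_def)
    then have "f i \<in> B" using f by (auto simp: bij_betw_def)
    have "(A' *\<^sub>v v) $ i = (\<Sum>j<n. of_int (c (f i) (f j)) * f j)"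
      using i by (simp add: A'_def A_def v_def scalar_prod_def lessThan_atLeast0)
    also have "\<dots> = (\<Sum>b'\<in>B. of_int (c (f i) b') * b')"
      by (rule sum.reindex_bij_betw[OF f])
    also have "\<dots> = x * f i" using c[OF \<open>f i \<in> B\<close>] by simp
    finally show "(A' *\<^sub>v v) $ i = (x \<cdot>\<^sub>v v) $ i" using i by (simp add: v_def)
  qed (simp_all add: A'_def A_def v_def)
  moreover have "v \<noteq> 0\<^sub>v n"
  proof
    assume "v = 0\<^sub>v n"
    then have "v $ k = 0" using k by simp
    then show False using k \<open>b0 \<noteq> 0\<close> by (simp add: v_def)
  qed
  ultimately have "eigenvalue A' x"
    unfolding eigenvalue_def eigenvector_def using A' by (intro exI[of _ v]) (auto simp: v_def)
  then have "poly (char_poly A') x = 0"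
    using eigenvalue_root_char_poly[OF A'] by simp
  moreover have "char_poly A' = map_poly of_int (char_poly A)"
    unfolding A'_def by (rule of_int_hom.char_poly_hom[OF A])
  moreover have "lead_coeff (char_poly A) = 1"
    using degree_monic_char_poly[OF A] by simp
  ultimately show ?thesis
    unfolding algebraic_int_altdef_ipoly by auto
qed

lemma algebraic_int_power_reduce:
  assumes "algebraic_int (x :: complex)"
  obtains n :: nat and c :: "nat \<Rightarrow> int" where "n > 0" "x ^ n = (\<Sum>i<n. of_int (c i) * x ^ i)"
proof -
  obtain p where p: "poly (map_poly of_int p) x = 0" "lead_coeff p = 1"
    using assms by (auto simp: algebraic_int_altdef_ipoly)
  define n where "n = degree p"
  have "n > 0"
  proof (rule ccontr)
    assume "\<not> n > 0"
    then obtain a where "p = [:a:]" by (metis degree_eq_zeroE n_def neq0_conv)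
    then show False using p by simp
  qed
  have "0 = (\<Sum>i\<le>n. of_int (coeff p i) * x ^ i)"
    using p(1) by (simp add: poly_altdef degree_map_poly coeff_map_poly n_def)
  also have "\<dots> = x ^ n + (\<Sum>i<n. of_int (coeff p i) * x ^ i)"
    using p(2) by (simp add: lessThan_Suc_atMost[symmetric] n_def)
  finally have "x ^ n = (\<Sum>i<n. of_int (- coeff p i) * x ^ i)"
    by (simp add: sum_negf add_eq_0_iff2)
  with \<open>n > 0\<close> show ?thesis by (rule that)
qed

text \<open>The products \<open>x ^ i * y ^ j\<close> with exponents below the degrees of monic
  equations for \<open>x\<close> and \<open>y\<close> generate one module stable under both.\<close>

lemma algebraic_int_common_module:
  assumes "algebraic_int (x :: complex)" "algebraic_int y"
  obtains B where "finite B" "1 \<in> B" "\<And>b. b \<in> B \<Longrightarrow> x * b \<in> int_span B"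
    "\<And>b. b \<in> B \<Longrightarrow> y * b \<in> int_span B"
proof -
  obtain n c where n: "n > 0" "x ^ n = (\<Sum>i<n. of_int (c i) * x ^ i)"
    using algebraic_int_power_reduce[OF assms(1)] by metis
  obtain m d where m: "m > 0" "y ^ m = (\<Sum>i<m. of_int (d i) * y ^ i)"
    using algebraic_int_power_reduce[OF assms(2)] by metis
  define B where "B = (\<lambda>(i, j). x ^ i * y ^ j) ` ({..<n} \<times> {..<m})"
  have fin: "finite B" by (simp add: B_def)
  have mem: "x ^ i * y ^ j \<in> B" if "i < n" "j < m" for i j
    using that by (force simp: B_def)
  have "1 \<in> B" using mem[of 0 0] n m by simp
  have "x * b \<in> int_span B" if b: "b \<in> B" for b
  proof -
    from b obtain i j where ij: "i < n" "j < m" "b = x ^ i * y ^ j" by (auto simp: B_def)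
    show ?thesis
    proof (cases "Suc i < n")
      case True
      with ij mem[of "Suc i" j] fin show ?thesis by (simp add: int_span_base mult.assoc)
    next
      case False
      with ij have "Suc i = n" by simp
      then have "x * b = x ^ n * y ^ j" using ij by (auto simp: mult.assoc)
      also have "\<dots> = (\<Sum>i<n. of_int (c i) * (x ^ i * y ^ j))"
        by (simp add: n(2) sum_distrib_right mult.assoc)
      also have "\<dots> \<in> int_span B"
        using ij by (intro int_span_sum int_span_of_int_mult int_span_base fin mem) auto
      finally show ?thesis .
    qed
  qed
  moreover have "y * b \<in> int_span B" if b: "b \<in> B" for b
  proof -
    from b obtain i j where ij: "i < n" "j < m" "b = x ^ i * y ^ j" by (auto simp: B_def)
    show ?thesis
    proof (cases "Suc j < m")
      case True
      with ij mem[of i "Suc j"] fin show ?thesis by (simp add: int_span_base mult_ac)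
    next
      case False
      with ij have "Suc j = m" by simp
      then have "y * b = x ^ i * y ^ m" using ij by (auto simp: mult_ac)
      also have "\<dots> = (\<Sum>k<m. of_int (d k) * (x ^ i * y ^ k))"
        by (simp add: m(2) sum_distrib_left mult_ac)
      also have "\<dots> \<in> int_span B"
        using ij by (intro int_span_sum int_span_of_int_mult int_span_base fin mem) auto
      finally show ?thesis .
    qed
  qed
  ultimately show ?thesis using that[OF fin \<open>1 \<in> B\<close>] by blast
qed

lemma algebraic_int_add:
  assumes "algebraic_int (x :: complex)" "algebraic_int y"
  shows "algebraic_int (x + y)"
proof -
  obtain B where B: "finite B" "1 \<in> B" "\<And>b. b \<in> B \<Longrightarrow> x * b \<in> int_span B"
    "\<And>b. b \<in> B \<Longrightarrow> y * b \<in> int_span B"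
    using algebraic_int_common_module[OF assms] by metis
  show ?thesis
    using B by (intro algebraic_int_if_stabilizes[of B _ 1])
      (auto simp: distrib_right intro!: int_span_add)
qed

lemma algebraic_int_mult:
  assumes "algebraic_int (x :: complex)" "algebraic_int y"
  shows "algebraic_int (x * y)"
proof -
  obtain B where B: "finite B" "1 \<in> B" "\<And>b. b \<in> B \<Longrightarrow> x * b \<in> int_span B"
    "\<And>b. b \<in> B \<Longrightarrow> y * b \<in> int_span B"
    using algebraic_int_common_module[OF assms] by metis
  have "x * y * b \<in> int_span B" if "b \<in> B" for b
    unfolding mult.assoc by (rule int_span_closed[OF B(3) B(4)[OF that]])
  then show ?thesis
    by (rule algebraic_int_if_stabilizes[OF B(1) _ B(2)]) simp_all
qed

lemma algebraic_int_diff: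
  "algebraic_int (x :: complex) \<Longrightarrow> algebraic_int y \<Longrightarrow> algebraic_int (x - y)"
  using algebraic_int_add[of x "- y"] by simp

lemma algebraic_int_of_int: "algebraic_int (of_int k :: complex)"
  by (simp add: int_imp_algebraic_int)

lemma algebraic_int_power: "algebraic_int (x :: complex) \<Longrightarrow> algebraic_int (x ^ n)"
  by (induction n) (auto intro: algebraic_int_mult int_imp_algebraic_int)

lemma algebraic_int_prod:
  "(\<And>i. i \<in> I \<Longrightarrow> algebraic_int (f i :: complex)) \<Longrightarrow> algebraic_int (prod f I)"
  by (induction I rule: infinite_finite_induct) (auto intro: algebraic_int_mult int_imp_algebraic_int)

lemma algebraic_int_poly:
  assumes "algebraic_int (x :: complex)"
  shows "algebraic_int (poly (map_poly of_int p) x)"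
  by (induction p)
    (auto simp: map_poly_pCons intro!: algebraic_int_add algebraic_int_mult algebraic_int_of_int assms)

lemma algebraic_int_root_of_unity:
  assumes "n > 0" "(z :: complex) ^ n = 1"
  shows "algebraic_int z"
proof (rule algebraic_int.intros)
  show "lead_coeff (monom 1 n - 1 :: complex poly) = 1"
  proof -
    have "degree (monom 1 n - 1 :: complex poly) = n"
      using assms(1) by (intro antisym degree_le le_degree)
        (auto simp: degree_monom_eq coeff_1 split: if_splits)
    then show ?thesis using assms(1) by simp
  qed
  show "\<forall>i. coeff (monom 1 n - 1 :: complex poly) i \<in> \<int>"
    by (auto simp: coeff_1)
  show "poly (monom 1 n - 1) z = 0" using assms by (simp add: poly_monom)
qed

text \<open>After cancelling powers of \<open>x\<close>, an integer equation for \<open>x\<close>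
  has a nonzero constant term, and its other terms are \<open>x\<close> times an algebraic
  integer.\<close>

lemma algebraic_int_divides_int:
  assumes "algebraic_int (x :: complex)" "x \<noteq> 0"
  obtains y and D :: int where "algebraic_int y" "D \<noteq> 0" "x * y = of_int D"
proof -
  have *: "\<exists>y (D :: int). algebraic_int y \<and> D \<noteq> 0 \<and> x * y = of_int D"
    if "poly (map_poly of_int q) x = 0" "q \<noteq> (0 :: int poly)" for q
    using that
  proof (induction q)
    case (pCons c r)
    have eq: "of_int c + x * poly (map_poly of_int r) x = 0"
      using pCons.prems by (simp add: map_poly_pCons)
    show ?case
    proof (cases "c = 0")
      case True
      with eq assms pCons show ?thesis by auto
    next
      case False
      moreover have "x * - poly (map_poly of_int r) x = of_int c"
        using eq by (simp add: add_eq_0_iff2 minus_equation_iff)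
      moreover have "algebraic_int (- poly (map_poly of_int r) x)"
        by (simp add: algebraic_int_poly assms)
      ultimately show ?thesis by blast
    qed
  qed simp
  obtain q where "poly (map_poly of_int q) x = 0" "lead_coeff q = (1 :: int)"
    using assms(1) by (auto simp: algebraic_int_altdef_ipoly)
  then have "q \<noteq> 0" by auto
  with * \<open>poly (map_poly of_int q) x = 0\<close> that show ?thesis by blast
qed

text \<open>A nonzero \<open>x\<close> divides some integer \<open>D \<noteq> 0\<close>, so every
  \<open>D / p ^ j\<close> is a rational algebraic integer, hence an integer. For
  \<open>j = \<bar>D\<bar>\<close> this fails, as then \<open>p ^ j > \<bar>D\<bar>\<close>.\<close>

lemma algebraic_int_infinitely_divisible_imp_0:
  assumes "algebraic_int (x :: complex)" "(p :: int) > 1"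
    and "\<And>j. algebraic_int (x / of_int p ^ j)"
  shows "x = 0"
proof (rule ccontr)
  assume "x \<noteq> 0"
  then obtain y and D :: int where y: "algebraic_int y" "D \<noteq> 0" "x * y = of_int D"
    using algebraic_int_divides_int assms(1) by metis
  define j where "j = nat \<bar>D\<bar>"
  have "algebraic_int (of_int D / of_int p ^ j :: complex)"
    using algebraic_int_mult[OF assms(3)[of j] y(1)] y(3) by simp
  moreover have "(of_int D / of_int p ^ j :: complex) \<in> \<rat>" by simp
  ultimately have "(of_int D / of_int p ^ j :: complex) \<in> \<int>"
    by (rule rational_algebraic_int_is_int)
  then obtain k where "of_int D / of_int p ^ j = (of_int k :: complex)" by (auto elim: Ints_cases)
  then have "(of_int D :: complex) = of_int (k * p ^ j)"
    using assms(2) by (simp add: field_simps)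
  then have "p ^ j dvd D" by (simp only: of_int_eq_iff) simp
  then have "p ^ j \<le> \<bar>D\<bar>"
    using dvd_imp_le_int[OF y(2)] by fastforce
  moreover have "\<bar>D\<bar> < p ^ j"
  proof -
    have "int j < 2 ^ j" by (metis of_nat_less_two_power)
    also have "(2 :: int) ^ j \<le> p ^ j" using assms(2) by (intro power_mono) auto
    finally show ?thesis by (simp add: j_def)
  qed
  ultimately show False by simp
qed

section \<open>Divisibility properties of the Tribonacci sequence\<close>

definition tribseq :: "(int \<Rightarrow> 'a :: ring_1) \<Rightarrow> bool" where
  "tribseq W \<longleftrightarrow> (\<forall>n. W (n + 3) = W (n + 2) + W (n + 1) + W n)"

lemma tribseq_T: "tribseq (\<lambda>n. of_int (T n))"
  by (simp add: tribseq_def T_rec)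

lemma tribseq_T_int: "tribseq T"
  by (simp add: tribseq_def T_rec)

lemma tribseq_shift: "tribseq W \<Longrightarrow> tribseq (\<lambda>n. W (n + k))"
  unfolding tribseq_def
proof
  fix n assume "\<forall>n. W (n + 3) = W (n + 2) + W (n + 1) + W n"
  then have "W ((n + k) + 3) = W ((n + k) + 2) + W ((n + k) + 1) + W (n + k)" by blast
  then show "W (n + 3 + k) = W (n + 2 + k) + W (n + 1 + k) + W (n + k)"
    by (simp add: add_ac)
qed

lemma tribseq_diff: "tribseq V \<Longrightarrow> tribseq W \<Longrightarrow> tribseq (\<lambda>n. V n - W n)"
  by (simp add: tribseq_def)

lemma tribseq_add: "tribseq V \<Longrightarrow> tribseq W \<Longrightarrow> tribseq (\<lambda>n. V n + W n)"
  by (simp add: tribseq_def)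

lemma tribseq_scale: "tribseq W \<Longrightarrow> tribseq (\<lambda>n. c * W n)"
  by (simp add: tribseq_def distrib_left)

lemma tribseq_eqI:
  assumes "tribseq V" "tribseq W" "V 0 = W 0" "V 1 = W 1" "V 2 = W 2"
  shows "V n = W n"
proof -
  have rV: "V (n + 3) = V (n + 2) + V (n + 1) + V n" and rW: "W (n + 3) = W (n + 2) + W (n + 1) + W n"
    for n using assms(1,2) by (simp_all add: tribseq_def)
  have "V n = W n \<and> V (n + 1) = W (n + 1) \<and> V (n + 2) = W (n + 2)"
  proof (induction n rule: int_induct[of _ 0])
    case base
    then show ?case using assms by simp
  next
    case (step1 i)
    then show ?case using rV[of i] rW[of i] by (simp add: add.assoc)
  next
    case (step2 i)
    then show ?case using rV[of "i - 1"] rW[of "i - 1"] by (simp add: algebra_simps)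
  qed
  then show ?thesis by simp
qed

text \<open>Three consecutive shifts of \<open>T\<close> form a basis of the integer solutions,
  because their matrix of initial values has determinant -1. Congruences of \<open>T\<close> thus
  pass to every integer solution.\<close>

lemma tribseq_expand:
  fixes W :: "int \<Rightarrow> int"
  assumes "tribseq W"
  defines "C \<equiv> W 2 - W 1 - W 0"
  shows "W n = (W 1 - W 0 - C) * T n + (W 0 - C) * T (n + 1) + C * T (n + 2)"
proof (rule tribseq_eqI[OF assms(1)])
  show "tribseq (\<lambda>n. (W 1 - W 0 - C) * T n + (W 0 - C) * T (n + 1) + C * T (n + 2))"
    by (intro tribseq_add tribseq_scale tribseq_shift tribseq_T_int)
  have "T 3 = 2" "T 4 = 4" using T_rec[of 0] T_rec[of 1] by (simp_all add: T_0 T_1 T_2)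
  then show "W 0 = (W 1 - W 0 - C) * T 0 + (W 0 - C) * T (0 + 1) + C * T (0 + 2)"
    "W 1 = (W 1 - W 0 - C) * T 1 + (W 0 - C) * T (1 + 1) + C * T (1 + 2)"
    "W 2 = (W 1 - W 0 - C) * T 2 + (W 0 - C) * T (2 + 1) + C * T (2 + 2)"
    by (simp_all add: C_def T_0 T_1 T_2)
qed

definition trib_period :: "int \<Rightarrow> int \<Rightarrow> bool" where
  "trib_period q L \<longleftrightarrow> (\<forall>n. q dvd T (n + L) - T n)"

lemma tribseq_dvd:
  fixes W :: "int \<Rightarrow> int"
  assumes "tribseq W" "q dvd W 0" "q dvd W 1" "q dvd W 2"
  shows "q dvd W n"
  by (subst tribseq_expand[OF assms(1)]) (intro dvd_add dvd_mult2 dvd_diff assms)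

lemma trib_periodI:
  assumes "q dvd T L" "q dvd T (L + 1) - 1" "q dvd T (L + 2) - 1"
  shows "trib_period q L"
  unfolding trib_period_def
proof
  fix n
  show "q dvd T (n + L) - T n"
    by (rule tribseq_dvd[of "\<lambda>n. T (n + L) - T n"])
      (use assms in \<open>auto intro!: tribseq_diff tribseq_shift tribseq_T_int simp: T_0 T_1 T_2 add.commute\<close>)
qed

lemma trib_period_tribseq:
  fixes W :: "int \<Rightarrow> int"
  assumes "trib_period q L" "tribseq W"
  shows "q dvd W (n + L) - W n"
proof -
  define C where "C = W 2 - W 1 - W 0"
  have "W (n + L) - W n = (W 1 - W 0 - C) * (T (n + L) - T n)
      + (W 0 - C) * (T ((n + 1) + L) - T (n + 1)) + C * (T ((n + 2) + L) - T (n + 2))"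
    by (subst (1 2) tribseq_expand[OF assms(2)]) (simp add: C_def algebra_simps)
  then show ?thesis
    using assms(1) by (simp add: trib_period_def)
qed

lemma trib_period_mult:
  assumes "trib_period q L"
  shows "trib_period q (w * L)"
  unfolding trib_period_def
proof
  fix n
  show "q dvd T (n + w * L) - T n"
  proof (induction w rule: int_induct[of _ 0])
    case base
    then show ?case by simp
  next
    case (step1 w)
    have "q dvd T ((n + w * L) + L) - T (n + w * L)"
      using assms by (simp add: trib_period_def)
    from dvd_add[OF this step1(2)] show ?case by (simp add: algebra_simps)
  next
    case (step2 w)
    have "q dvd T ((n + (w - 1) * L) + L) - T (n + (w - 1) * L)"
      using assms by (simp add: trib_period_def)
    from dvd_diff[OF step2(2) this] show ?case by (simp add: algebra_simps)
  qed
qed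

section \<open>Increments along a period modulo higher powers\<close>

text \<open>The quotient is again an integer solution, so periodicity modulo \<open>q\<close>
  applies to it as well and yields a further factor \<open>q\<close>.\<close>

lemma tribseq_difference_quotient:
  fixes W :: "int \<Rightarrow> int"
  assumes "trib_period q L" "tribseq W" "q \<noteq> 0"
  obtains Y where "tribseq Y" "\<And>n. W (n + L) - W n = q * Y n"
proof
  define Y where "Y n = (W (n + L) - W n) div q" for n
  show eq: "W (n + L) - W n = q * Y n" for n
    using trib_period_tribseq[OF assms(1,2)] by (simp add: Y_def)
  have "tribseq (\<lambda>n. q * Y n)"
    unfolding eq[symmetric] by (intro tribseq_diff tribseq_shift assms(2))
  then show "tribseq Y"
    using \<open>q \<noteq> 0\<close> by (simp add: tribseq_def distrib_left[symmetric])
qed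

text \<open>The difference telescopes into increments \<open>q * Y (n + i * L)\<close>, each
  congruent to \<open>q * Y n\<close> modulo \<open>q * q\<close>.\<close>

lemma tribseq_first_order:
  fixes W :: "int \<Rightarrow> int"
  assumes "trib_period q L" "tribseq W" "q \<noteq> 0"
  shows "q * q dvd W (n + w * L) - W n - w * (W (n + L) - W n)"
proof -
  obtain Y where Y: "tribseq Y" "\<And>n. W (n + L) - W n = q * Y n"
    using tribseq_difference_quotient[OF assms] by metis
  have *: "q * q dvd q * (Y (n + w * L) - Y n)" for w
    using trib_period_tribseq[OF trib_period_mult[OF assms(1)] Y(1)] by simp
  show ?thesis
  proof (induction w rule: int_induct[of _ 0])
    case base
    then show ?case by simp
  next
    case (step1 w)
    have "n + w * L + L = n + (w + 1) * L" by (simp add: algebra_simps)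
    then have "W (n + (w + 1) * L) - W n - (w + 1) * (W (n + L) - W n) =
        (W (n + w * L) - W n - w * (W (n + L) - W n)) + q * (Y (n + w * L) - Y n)"
      using Y(2)[of "n + w * L"] Y(2)[of n] by (simp add: algebra_simps)
    then show ?case using dvd_add[OF step1(2) *[of w]] by (simp only:)
  next
    case (step2 w)
    have "n + (w - 1) * L + L = n + w * L" by (simp add: algebra_simps)
    then have "W (n + (w - 1) * L) - W n - (w - 1) * (W (n + L) - W n) =
        (W (n + w * L) - W n - w * (W (n + L) - W n)) - q * (Y (n + (w - 1) * L) - Y n)"
      using Y(2)[of "n + (w - 1) * L"] Y(2)[of n] by (simp add: algebra_simps)
    then show ?case using dvd_diff[OF step2(2) *[of "w - 1"]] by (simp only:)
  qed
qed

text \<open>Newton's forward difference formula, cut off after the second difference; every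
  difference contributes a factor \<open>q\<close>.\<close>

lemma tribseq_second_order:
  fixes W :: "int \<Rightarrow> int" and j :: nat
  assumes "trib_period q L" "tribseq W" "q \<noteq> 0" and "\<And>n. X n = W (n + L) - W n"
  shows "q ^ 3 dvd W (n + int j * L) - W n - int j * X n - int (j choose 2) * (X (n + L) - X n)"
proof -
  obtain Y where Y: "tribseq Y" "\<And>n. W (n + L) - W n = q * Y n"
    using tribseq_difference_quotient[OF assms(1-3)] by metis
  have X: "X n = q * Y n" for n using Y assms(4) by simp
  show ?thesis
  proof (induction j)
    case 0
    then show ?case by (simp add: numeral_2_eq_2)
  next
    case (Suc j)
    have "q * (q * q) dvd q * (Y (n + int j * L) - Y n - int j * (Y (n + L) - Y n))"
      by (intro mult_dvd_mono tribseq_first_order assms(1,3) Y(1) dvd_refl)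
    then have 1: "q ^ 3 dvd q * (Y (n + int j * L) - Y n - int j * (Y (n + L) - Y n))"
      by (simp add: power3_eq_cube mult.assoc)
    have "Suc j choose 2 = (j choose 2) + j"
      by (simp add: numeral_2_eq_2)
    then have c: "int (Suc j choose 2) = int (j choose 2) + int j" by simp
    have "W (n + int (Suc j) * L) = W (n + int j * L) + q * Y (n + int j * L)"
      using Y(2)[of "n + int j * L"] by (simp add: algebra_simps)
    then have "W (n + int (Suc j) * L) - W n - int (Suc j) * X n
        - int (Suc j choose 2) * (X (n + L) - X n)
      = (W (n + int j * L) - W n - int j * X n - int (j choose 2) * (X (n + L) - X n))
        + q * (Y (n + int j * L) - Y n - int j * (Y (n + L) - Y n))"
      unfolding c by (simp add: X algebra_simps)
    then show ?case
      using dvd_add[OF Suc.IH 1] by (simp only:)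
  qed
qed

text \<open>In the second-order expansion with \<open>j = p\<close>, the coefficient
  \<open>p choose 2\<close> is a multiple of \<open>p\<close> because \<open>p\<close> is odd;
  together with \<open>int p dvd q\<close> this absorbs the second difference and the
  remainder.\<close>

lemma tribseq_prime_multiple:
  fixes W :: "int \<Rightarrow> int"
  assumes "trib_period q L" "tribseq W" "q \<noteq> 0" "int p dvd q" "odd p"
  shows "q * int p * int p dvd W (n + int p * L) - W n - int p * (W (n + L) - W n)"
proof -
  define X where "X n = W (n + L) - W n" for n
  obtain e where e: "q = int p * e" using assms(4) by blast
  have "q * int p * int p dvd q ^ 3"
    by (simp add: e power3_eq_cube)
  then have 1: "q * int p * int p dvd
      W (n + int p * L) - W n - int p * X n - int (p choose 2) * (X (n + L) - X n)"
    using tribseq_second_order[OF assms(1-3) X_def] by (rule dvd_trans)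
  obtain Y where Y: "tribseq Y" "\<And>n. W (n + L) - W n = q * Y n"
    using tribseq_difference_quotient[OF assms(1-3)] by metis
  have "q dvd Y (n + L) - Y n" by (rule trib_period_tribseq[OF assms(1) Y(1)])
  then have "q * q dvd q * (Y (n + L) - Y n)" by simp
  then have "q * q dvd X (n + L) - X n"
    unfolding X_def Y(2) by (simp only: right_diff_distrib)
  moreover have "int p dvd int (p choose 2)"
  proof -
    obtain m where "p = 2 * m + 1" using \<open>odd p\<close> by (elim oddE)
    then have "p choose 2 = p * m" by (simp add: choose_two)
    then show ?thesis by simp
  qed
  ultimately have "int p * (q * q) dvd int (p choose 2) * (X (n + L) - X n)"
    by (rule mult_dvd_mono[rotated])
  moreover have "q * int p * int p dvd int p * (q * q)" by (simp add: e)
  ultimately have "q * int p * int p dvd int (p choose 2) * (X (n + L) - X n)"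
    by (meson dvd_trans)
  from dvd_add[OF 1 this] show ?thesis by (simp add: X_def)
qed

text \<open>One induction proves both claims: the expansion along \<open>N * p ^ k\<close> needs its
  period property, and the next period property is read off from the expansion.\<close>

lemma trib_lift:
  assumes "trib_period (int p) N" "odd p"
  shows "trib_period (int p ^ (k + 1)) (N * int p ^ k) \<and>
    (\<forall>n. int p ^ (k + 2) dvd T (n + N * int p ^ k) - T n - int p ^ k * (T (n + N) - T n))"
proof (induction k)
  case 0
  then show ?case using assms by simp
next
  case (Suc k)
  have "p \<noteq> 0" using assms by presburger
  have second: "int p ^ (k + 3) dvd
      T (n + N * int p ^ (k + 1)) - T n - int p ^ (k + 1) * (T (n + N) - T n)" for n
  proof -
    have "int p ^ (k + 1) * int p * int p dvd T (n + int p * (N * int p ^ k)) - T n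
        - int p * (T (n + N * int p ^ k) - T n)"
      using Suc.IH \<open>p \<noteq> 0\<close> assms(2)
      by (intro tribseq_prime_multiple tribseq_T_int) auto
    then have 1: "int p ^ (k + 3) dvd T (n + N * int p ^ (k + 1)) - T n
        - int p * (T (n + N * int p ^ k) - T n)"
      by (simp add: numeral_3_eq_3 algebra_simps)
    have "int p * int p ^ (k + 2) dvd
        int p * (T (n + N * int p ^ k) - T n - int p ^ k * (T (n + N) - T n))"
      using Suc.IH by (intro mult_dvd_mono) auto
    then have "int p ^ (k + 3) dvd
        int p * (T (n + N * int p ^ k) - T n - int p ^ k * (T (n + N) - T n))"
      by (simp add: numeral_3_eq_3 algebra_simps)
    from dvd_add[OF 1 this] show ?thesis by (simp add: algebra_simps)
  qed
  moreover have "trib_period (int p ^ (k + 2)) (N * int p ^ (k + 1))"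
    unfolding trib_period_def
  proof
    fix n
    have "int p ^ (k + 2) dvd int p ^ (k + 3)" by (rule le_imp_power_dvd) simp
    from dvd_trans[OF this second[of n]]
    have 1: "int p ^ (k + 2) dvd
      T (n + N * int p ^ (k + 1)) - T n - int p ^ (k + 1) * (T (n + N) - T n)" .
    have "int p ^ (k + 1) * int p dvd int p ^ (k + 1) * (T (n + N) - T n)"
      using assms(1) by (intro mult_dvd_mono) (auto simp: trib_period_def)
    then have "int p ^ (k + 2) dvd int p ^ (k + 1) * (T (n + N) - T n)"
      by (simp add: algebra_simps)
    from dvd_add[OF 1 this] show "int p ^ (k + 2) dvd T (n + N * int p ^ (k + 1)) - T n"
      by simp
  qed
  ultimately show ?case by (simp add: eval_nat_numeral)
qed

text \<open>A first-order Taylor expansion, with \<open>T (n + N) - T n\<close> in the role of the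
  derivative.\<close>

lemma trib_lift_multiple:
  assumes "trib_period (int p) N" "odd p"
  shows "int p ^ (k + 2) dvd T (n + w * (N * int p ^ k)) - T n - w * int p ^ k * (T (n + N) - T n)"
proof -
  have "p \<noteq> 0" using assms by presburger
  define L where "L = N * int p ^ k"
  have "int p ^ (k + 1) * int p ^ (k + 1) dvd T (n + w * L) - T n - w * (T (n + L) - T n)"
    using trib_lift[OF assms] \<open>p \<noteq> 0\<close> unfolding L_def
    by (intro tribseq_first_order tribseq_T_int) auto
  moreover have "int p ^ (k + 2) dvd int p ^ (k + 1) * int p ^ (k + 1)"
    unfolding power_add[symmetric] by (rule le_imp_power_dvd) simp
  ultimately have 1: "int p ^ (k + 2) dvd T (n + w * L) - T n - w * (T (n + L) - T n)"
    by (rule dvd_trans[rotated])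
  have "int p ^ (k + 2) dvd w * (T (n + L) - T n - int p ^ k * (T (n + N) - T n))"
    using trib_lift[OF assms] by (simp add: L_def)
  from dvd_add[OF 1 this] show ?thesis by (simp add: L_def algebra_simps)
qed

text \<open>The increment divided by \<open>q\<close> has period \<open>N\<close> modulo
  \<open>q\<close>. Simplicity of a zero is therefore a property of its class modulo
  \<open>N\<close>.\<close>

lemma trib_increment_invariant:
  assumes "trib_period q N" "q \<noteq> 0" "N dvd m - n"
  shows "q * q dvd T (m + N) - T m \<longleftrightarrow> q * q dvd T (n + N) - T n"
proof -
  obtain Y where Y: "tribseq Y" "\<And>n. T (n + N) - T n = q * Y n"
    using tribseq_difference_quotient[OF assms(1) tribseq_T_int assms(2)] by metis
  obtain w where "m - n = N * w" using assms(3) by (auto simp: dvd_def)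
  then have "m = n + w * N" by (simp add: algebra_simps)
  then have "q dvd Y m - Y n"
    using trib_period_tribseq[OF trib_period_mult[OF assms(1)] Y(1)] by simp
  then have "q dvd Y m \<longleftrightarrow> q dvd Y n"
    by (metis dvd_diff_commute dvd_add_right_iff diff_add_cancel)
  then show ?thesis using assms(2) by (simp add: Y(2))
qed

text \<open>Newton iteration: each step changes \<open>n\<close> by a multiple of
  \<open>N * p ^ k\<close> with \<open>k \<ge> s\<close>, so the class of \<open>m\<close> modulo
  \<open>N * p ^ s\<close> is kept. The point \<open>n0\<close> only witnesses that the derivative
  is nonzero on the class modulo \<open>N\<close>.\<close>

lemma trib_hensel:
  assumes "prime p" "odd p" "trib_period (int p) N"
    and incr: "\<not> int p * int p dvd T (n0 + N) - T n0"
    and "N dvd m - n0" "int p ^ (s + 1) dvd T m" "k \<ge> s"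
  shows "\<exists>n. N * int p ^ s dvd n - m \<and> int p ^ (k + 1) dvd T n"
  using \<open>k \<ge> s\<close>
proof (induction k rule: dec_induct)
  case base
  then show ?case using assms by (intro exI[of _ m]) simp
next
  case (step k)
  then obtain n where n: "N * int p ^ s dvd n - m" "int p ^ (k + 1) dvd T n" by blast
  have p0: "int p \<noteq> 0" using assms(2) by presburger
  have "N dvd n - m" using n(1) by (rule dvd_mult_left)
  from dvd_add[OF this assms(5)] have "N dvd n - n0" by simp
  then have nd: "\<not> int p * int p dvd T (n + N) - T n"
    using incr trib_increment_invariant[OF assms(3) p0] by blast
  obtain c where c: "T n = int p ^ (k + 1) * c" using n(2) by blast
  obtain e where e: "T (n + N) - T n = int p * e"
    using assms(3) by (auto simp: trib_period_def dvd_def)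
  have "\<not> int p dvd e" using nd e p0 by simp
  then have "coprime e (int p)"
    using \<open>prime p\<close> by (metis coprime_commute prime_imp_coprime prime_nat_int_transfer)
  then obtain u v where uv: "u * e + v * int p = 1"
    using bezout_int[of e "int p"] by (auto simp: coprime_iff_gcd_eq_1)
  \<comment> \<open>Since \<open>u\<close> inverts \<open>e\<close> modulo \<open>p\<close>, this
    \<open>t\<close> solves \<open>c + t * e = 0\<close> modulo \<open>p\<close>.\<close>
  define t where "t = - (c * u)"
  have "c + t * e = c * (1 - u * e)" by (simp add: t_def algebra_simps)
  also have "\<dots> = int p * (c * v)" using uv by (simp add: algebra_simps flip: uv)
  finally have "int p dvd c + t * e" by simp
  then have "int p ^ (k + 1) * int p dvd int p ^ (k + 1) * (c + t * e)" by simp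
  moreover have "T n + t * int p ^ k * (T (n + N) - T n) = int p ^ (k + 1) * (c + t * e)"
    unfolding e by (simp add: c algebra_simps)
  ultimately have "int p ^ (k + 2) dvd T n + t * int p ^ k * (T (n + N) - T n)"
    by (simp add: algebra_simps)
  from dvd_add[OF trib_lift_multiple[OF assms(3,2), of k n t] this]
  have "int p ^ (Suc k + 1) dvd T (n + t * (N * int p ^ k))" by simp
  moreover have "N * int p ^ s dvd t * (N * int p ^ k)"
    using step(1) by (intro dvd_mult mult_dvd_mono le_imp_power_dvd) auto
  from dvd_add[OF n(1) this] have "N * int p ^ s dvd (n + t * (N * int p ^ k)) - m"
    by (simp only: diff_add_eq)
  ultimately show ?case by blast
qed

section \<open>Fast evaluation of the sequence modulo M\<close>

text \<open>
  A triple stands for \<open>(T n, T (n + 1), T (n + 2))\<close> modulo \<open>M\<close>.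
\<close>

fun trib_add :: "int \<Rightarrow> int \<times> int \<times> int \<Rightarrow> int \<times> int \<times> int \<Rightarrow> int \<times> int \<times> int" where
  "trib_add M (a, b, c) (x, y, z) =
    (((2 * b - c) * x + (2 * a + b - c) * y + (c - b - a) * z) mod M,
     ((2 * b - c) * y + (2 * a + b - c) * z + (c - b - a) * (x + y + z)) mod M,
     ((2 * b - c) * z + (2 * a + b - c) * (x + y + z) + (c - b - a) * (x + 2 * y + 2 * z)) mod M)"

fun trib_step :: "int \<Rightarrow> bool \<Rightarrow> int \<times> int \<times> int \<Rightarrow> int \<times> int \<times> int" where
  "trib_step M e (x, y, z) = (if e then (x, y, z) else (y, z, (x + y + z) mod M))"

fun trib_double :: "int \<Rightarrow> int \<times> int \<times> int \<Rightarrow> int \<times> int \<times> int" where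
  "trib_double M v = trib_add M v v"

text \<open>Binary doubling keeps the later evaluations feasible, and \<open>trib_double\<close>
  lets the recursive call occur only once. Negative indices get the triple at 0, so values are
  meaningful only for \<open>n \<ge> 0\<close>.\<close>

function trib_mod :: "int \<Rightarrow> int \<Rightarrow> int \<times> int \<times> int" where
  "trib_mod M n = (if n \<le> 0 then (0, 1, 1)
     else trib_step M (even n) (trib_double M (trib_mod M (n div 2))))"
  by auto
termination by (relation "measure (\<lambda>(M, n). nat n)") auto

declare trib_mod.simps [simp del]

fun trib_rep :: "int \<Rightarrow> int \<Rightarrow> int \<times> int \<times> int \<Rightarrow> bool" where
  "trib_rep M n (x, y, z) \<longleftrightarrow> M dvd T n - x \<and> M dvd T (n + 1) - y \<and> M dvd T (n + 2) - z"

text \<open>The shift by \<open>m\<close> solves the recurrence, so its expansion is an addition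
  formula; \<open>trib_add\<close> is this formula modulo \<open>M\<close>.\<close>

lemma trib_add_formula:
  "T (n + m) = (2 * T (m + 1) - T (m + 2)) * T n + (2 * T m + T (m + 1) - T (m + 2)) * T (n + 1)
     + (T (m + 2) - T (m + 1) - T m) * T (n + 2)"
  using tribseq_expand[OF tribseq_shift[OF tribseq_T_int, of m], of n] by (simp add: add.commute)

lemma dvd_diff_mod: "(M :: int) dvd a - b \<Longrightarrow> M dvd a - b mod M"
  by (metis mod_eq_dvd_iff mod_mod_trivial)

lemma dvd_diff_add: "(M :: int) dvd a - b \<Longrightarrow> M dvd c - d \<Longrightarrow> M dvd (a + c) - (b + d)"
  by (metis add_diff_add dvd_add)

lemma dvd_diff_mult: "(M :: int) dvd a - b \<Longrightarrow> M dvd c - d \<Longrightarrow> M dvd a * c - b * d"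
  by (metis mod_eq_dvd_iff mod_mult_cong)

lemma dvd_diff_diff: "(M :: int) dvd a - b \<Longrightarrow> M dvd c - d \<Longrightarrow> M dvd (a - c) - (b - d)"
  by (metis mod_eq_dvd_iff mod_diff_cong)

lemma trib_rep_add:
  assumes "trib_rep M m v" "trib_rep M n w"
  shows "trib_rep M (n + m) (trib_add M v w)"
proof -
  obtain a b c x y z where [simp]: "v = (a, b, c)" "w = (x, y, z)" by (metis prod_cases3)
  have r: "T (n + 3) = T n + T (n + 1) + T (n + 2)"
    "T (n + 4) = T n + 2 * T (n + 1) + 2 * T (n + 2)"
    using T_rec[of n] T_rec[of "n + 1"] by (simp_all add: algebra_simps)
  have sh: "n + m + 1 = (n + 1) + m" "n + m + 2 = (n + 2) + m" by simp_all
  have ar: "n + 1 + 1 = n + 2" "n + 1 + 2 = n + 3" "n + 2 + 1 = n + 3" "n + 2 + 2 = n + 4" by simp_all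
  have d: "M dvd T m - a" "M dvd T (m + 1) - b" "M dvd T (m + 2) - c"
    "M dvd T n - x" "M dvd T (n + 1) - y" "M dvd T (n + 2) - z"
    using assms by simp_all
  show ?thesis
    unfolding \<open>v = _\<close> \<open>w = _\<close> trib_add.simps trib_rep.simps sh trib_add_formula[of _ m] ar r
    by (intro conjI dvd_diff_mod dvd_diff_add dvd_diff_mult dvd_diff_diff d) simp_all
qed

lemma trib_rep_mod: "n \<ge> 0 \<Longrightarrow> trib_rep M n (trib_mod M n)"
proof (induction M n rule: trib_mod.induct)
  case (1 M n)
  show ?case
  proof (cases "n = 0")
    case True
    then show ?thesis by (simp add: trib_mod.simps T_0 T_1 T_2)
  next
    case False
    with 1 have n: "\<not> n \<le> 0" by simp
    define h where "h = n div 2"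
    have "trib_rep M h (trib_mod M h)"
      using 1(1)[OF n] n by (simp add: h_def)
    then have d: "trib_rep M (h + h) (trib_double M (trib_mod M h))"
      unfolding trib_double.simps by (intro trib_rep_add)
    obtain x y z where xyz: "trib_double M (trib_mod M h) = (x, y, z)" by (metis prod_cases3)
    have eq: "trib_mod M n = trib_step M (even n) (x, y, z)"
      using n by (subst trib_mod.simps) (simp add: h_def[symmetric] xyz del: trib_double.simps)
    show ?thesis
    proof (cases "even n")
      case True
      then have "h + h = n" by (simp add: h_def)
      then show ?thesis using d eq xyz True by simp
    next
      case False
      then have n1: "n = h + h + 1" unfolding h_def by presburger
      have dd: "M dvd T (h + h) - x" "M dvd T (h + h + 1) - y" "M dvd T (h + h + 2) - z"
        using d xyz by simp_all
      have "M dvd T (h + h + 3) - (x + y + z) mod M"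
        using dvd_diff_add[OF dvd_diff_add[OF dd(1,2)] dd(3)] T_rec[of "h + h"]
        by (intro dvd_diff_mod) (simp add: add_ac)
      then show ?thesis using dd eq False n1 by (simp add: algebra_simps)
    qed
  qed
qed

lemma trib_mod_correct:
  assumes "n \<ge> 0" "trib_mod M n = (x, y, z)"
  shows "M dvd T n - x" "M dvd T (n + 1) - y" "M dvd T (n + 2) - z"
  using trib_rep_mod[OF assms(1), of M] assms(2) by simp_all

section \<open>Twisted sums and conjugation\<close>

text \<open>The factorisation of \<open>t ^ N - 1\<close> into linear factors, taken at
  \<open>t = - c / y\<close>; only \<open>y = 0\<close> needs a separate argument.\<close>

lemma prod_roots_of_unity_linear:
  fixes c y :: complex
  assumes "N > 0"
  shows "(\<Prod>z | z ^ N = 1. z * y + c) = c ^ N - (- y) ^ N"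
proof (cases "y = 0")
  case True
  then show ?thesis using assms card_roots_unity_eq[of N] by (simp add: power_0_left)
next
  case False
  define P :: "complex poly" where "P = monom 1 N - 1"
  have deg: "degree P = N"
    unfolding P_def using assms by (intro antisym degree_le le_degree)
      (auto simp: degree_monom_eq split: if_splits)
  then have lc: "lead_coeff P = 1" using assms by (simp add: P_def)
  have roots: "poly P z = 0 \<longleftrightarrow> z ^ N = 1" for z by (simp add: P_def poly_monom)
  have "rsquarefree P"
    unfolding rsquarefree_roots
  proof (intro allI notI)
    fix z assume z: "poly P z = 0 \<and> poly (pderiv P) z = 0"
    then have "of_nat N * z ^ (N - 1) = 0"
      by (simp add: P_def pderiv_diff pderiv_monom poly_monom)
    then have "z = 0" using assms by simp
    then show False using z assms by (simp add: roots power_0_left)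
  qed
  from complex_poly_decompose_rsquarefree[OF this]
  have "(\<Prod>z | z ^ N = 1. [:- z, 1:]) = P" using lc roots by simp
  then have "poly (\<Prod>z | z ^ N = 1. [:- z, 1:]) t = poly P t" for t by (simp only:)
  then have P: "t ^ N - 1 = (\<Prod>z | z ^ N = 1. t - z)" for t :: complex
    by (simp add: P_def poly_monom poly_prod)
  have "(\<Prod>z | z ^ N = 1. z * y + c) = (\<Prod>z | z ^ N = 1. (- y) * (- c / y - z))"
    using False by (intro prod.cong) (auto simp: field_simps)
  also have "\<dots> = (- y) ^ N * ((- c / y) ^ N - 1)"
    by (simp only: prod.distrib prod_constant P card_roots_unity_eq[OF assms])
  also have "\<dots> = c ^ N - (- y) ^ N"
    using False by (simp add: right_diff_distrib flip: power_mult_distrib)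
  finally show ?thesis .
qed

text \<open>Congruence modulo \<open>q\<close> in the ring of all algebraic integers.\<close>

definition acong :: "complex \<Rightarrow> complex \<Rightarrow> complex \<Rightarrow> bool" where
  "acong q a b \<longleftrightarrow> algebraic_int ((a - b) / q)"

lemma acong_refl: "acong q a a"
  by (simp add: acong_def)

lemma acong_trans: "acong q a b \<Longrightarrow> acong q b c \<Longrightarrow> acong q a c"
  unfolding acong_def using algebraic_int_add[of "(a - b) / q" "(b - c) / q"]
  by (simp add: diff_divide_distrib)

lemma acong_mult:
  assumes "acong q a b" "acong q c d" "algebraic_int a" "algebraic_int d"
  shows "acong q (a * c) (b * d)"
proof -
  have "(a * c - b * d) / q = a * ((c - d) / q) + (a - b) / q * d"
    by (simp add: algebra_simps diff_divide_distrib)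
  moreover have "algebraic_int (a * ((c - d) / q) + (a - b) / q * d)"
    using assms unfolding acong_def by (intro algebraic_int_add algebraic_int_mult)
  ultimately show ?thesis unfolding acong_def by (simp only:)
qed

lemma acong_prod:
  assumes "\<And>i. i \<in> I \<Longrightarrow> acong q (f i) (g i)"
    and "\<And>i. i \<in> I \<Longrightarrow> algebraic_int (f i)" "\<And>i. i \<in> I \<Longrightarrow> algebraic_int (g i)"
  shows "acong q (prod f I) (prod g I)"
  using assms
  by (induction I rule: infinite_finite_induct)
    (auto intro!: acong_mult acong_refl algebraic_int_prod)

text \<open>
  The norm of \<open>x + y + z\<close> over the \<open>N\<close>-th powers of its summands: it depends on \<open>x\<close>, \<open>y\<close>, \<open>z\<close>
  only through \<open>x ^ N\<close>, \<open>y ^ N\<close>, \<open>z ^ N\<close>, so it does not see the part of \<open>\<lambda> ^ d\<close> that is not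
  close to \<open>1\<close> when \<open>d\<close> is \<open>p\<close>-adically small.
\<close>

definition twist_norm :: "nat \<Rightarrow> complex \<Rightarrow> complex \<Rightarrow> complex \<Rightarrow> complex" where
  "twist_norm N x y z = (\<Prod>a | a ^ N = 1. \<Prod>b | b ^ N = 1. \<Prod>c | c ^ N = 1. a * x + b * y + c * z)"

lemma twist_norm_swap12: "twist_norm N x y z = twist_norm N y x z"
  unfolding twist_norm_def by (subst prod.swap) (simp add: add.commute)

lemma twist_norm_swap23: "twist_norm N x y z = twist_norm N x z y"
  unfolding twist_norm_def
  by (rule prod.cong[OF refl], subst prod.swap) (simp add: add.assoc add.commute[of "_ * y"])

lemma twist_norm_swap13: "twist_norm N x y z = twist_norm N z y x"
  by (metis twist_norm_swap12 twist_norm_swap23)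

lemma twist_norm_factor:
  assumes "N > 0"
  shows "twist_norm N x y z = (\<Prod>a | a ^ N = 1. \<Prod>b | b ^ N = 1. (a * x + b * y) ^ N - (- z) ^ N)"
  unfolding twist_norm_def
proof (intro prod.cong refl)
  fix a b :: complex
  have "(\<Prod>c | c ^ N = 1. a * x + b * y + c * z) = (\<Prod>c | c ^ N = 1. c * z + (a * x + b * y))"
    by (simp add: add.commute)
  then show "(\<Prod>c | c ^ N = 1. a * x + b * y + c * z) = (a * x + b * y) ^ N - (- z) ^ N"
    using prod_roots_of_unity_linear[OF assms] by simp
qed

text \<open>In \<open>twist_norm_factor\<close> the third argument enters only through its
  \<open>N\<close>-th power, up to sign. The swap lemmas carry this over to the other
  arguments.\<close>

lemma acong_twist_norm_third:
  assumes "N > 0" "algebraic_int x" "algebraic_int y" "algebraic_int z" "algebraic_int z'"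
    and "acong q (z ^ N) (z' ^ N)"
  shows "acong q (twist_norm N x y z) (twist_norm N x y z')"
  unfolding twist_norm_factor[OF assms(1)]
proof (intro acong_prod)
  fix a b :: complex assume "a \<in> {a. a ^ N = 1}" "b \<in> {b. b ^ N = 1}"
  have "((a * x + b * y) ^ N - (- z) ^ N - ((a * x + b * y) ^ N - (- z') ^ N)) / q
      = - ((- 1) ^ N * ((z ^ N - z' ^ N) / q))"
    by (simp add: power_minus[of z] power_minus[of z'] diff_divide_distrib algebra_simps)
  moreover have "algebraic_int ((- 1) ^ N * ((z ^ N - z' ^ N) / q))"
    using assms(6) unfolding acong_def
    by (intro algebraic_int_mult algebraic_int_power) auto
  ultimately show "acong q ((a * x + b * y) ^ N - (- z) ^ N) ((a * x + b * y) ^ N - (- z') ^ N)"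
    by (simp add: acong_def)
qed (use assms in \<open>auto intro!: algebraic_int_prod algebraic_int_diff algebraic_int_power
      algebraic_int_add algebraic_int_mult intro: algebraic_int_root_of_unity\<close>)

lemma acong_twist_norm:
  assumes "N > 0" "acong q (x ^ N) (x' ^ N)" "acong q (y ^ N) (y' ^ N)" "acong q (z ^ N) (z' ^ N)"
    and "algebraic_int x" "algebraic_int y" "algebraic_int z"
      "algebraic_int x'" "algebraic_int y'" "algebraic_int z'"
  shows "acong q (twist_norm N x y z) (twist_norm N x' y' z')"
proof -
  have "acong q (twist_norm N x y z) (twist_norm N x y z')"
    using assms by (intro acong_twist_norm_third)
  moreover have "acong q (twist_norm N x y z') (twist_norm N x y' z')"
    using assms unfolding twist_norm_swap23[of N x _ z'] by (intro acong_twist_norm_third)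
  moreover have "acong q (twist_norm N x y' z') (twist_norm N x' y' z')"
    using assms unfolding twist_norm_swap13[of N _ y' z'] by (intro acong_twist_norm_third)
  ultimately show ?thesis by (blast intro: acong_trans)
qed

lemma prod_divisible_if_factor:
  assumes "finite I" "i \<in> I" "algebraic_int (f i / q :: complex)"
    "\<And>j. j \<in> I \<Longrightarrow> algebraic_int (f j)"
  shows "algebraic_int (prod f I / q)"
proof -
  have "prod f I / q = f i / q * prod f (I - {i})"
    using assms(1,2) by (simp add: prod.remove)
  moreover have "algebraic_int (f i / q * prod f (I - {i}))"
    using assms by (intro algebraic_int_mult algebraic_int_prod) auto
  ultimately show ?thesis by (simp only:)
qed

text \<open>The factor with all three roots of unity equal to 1 is \<open>x + y + z\<close>.\<close>

lemma twist_norm_divisible: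
  assumes "N > 0" "algebraic_int x" "algebraic_int y" "algebraic_int z"
    "algebraic_int ((x + y + z) / q)"
  shows "algebraic_int (twist_norm N x y z / q)"
proof -
  have fin: "finite {a :: complex. a ^ N = 1}" using assms(1) by (intro finite_roots_unity) simp
  show ?thesis unfolding twist_norm_def
    using assms
    by (intro prod_divisible_if_factor[OF fin, of 1])
      (auto intro!: algebraic_int_prod algebraic_int_add algebraic_int_mult
        intro: algebraic_int_root_of_unity)
qed

text \<open>
  Eliminates the root of unity \<open>z\<close> from \<open>u\<^sub>1 + z u\<^sub>2 + u\<^sub>3 / z = 0\<close>: the summands \<open>z u\<^sub>2\<close> and \<open>u\<^sub>3 / z\<close>
  have sum \<open>- u\<^sub>1\<close>, product \<open>u\<^sub>2 u\<^sub>3\<close>, and \<open>N\<close>-th powers \<open>u\<^sub>2 ^ N\<close> and \<open>u\<^sub>3 ^ N\<close>.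
\<close>

fun lucas_V :: "complex \<Rightarrow> complex \<Rightarrow> nat \<Rightarrow> complex" where
  "lucas_V P Q 0 = 2"
| "lucas_V P Q (Suc 0) = P"
| "lucas_V P Q (Suc (Suc n)) = P * lucas_V P Q (Suc n) - Q * lucas_V P Q n"

lemma lucas_V_roots: "lucas_V (a + b) (a * b) n = a ^ n + b ^ n"
  by (induction "a + b" "a * b" n rule: lucas_V.induct) (auto simp: algebra_simps)

text \<open>Conjugation inverts the \<open>z\<close>s and exchanges \<open>u2\<close> and
  \<open>u3\<close>. Multiplied by \<open>z1 * z2 * z3\<close>, the conjugate relation has the same
  \<open>u2\<close> and \<open>u3\<close> terms as \<open>z1\<close> times the original one, so only
  the \<open>u1\<close> terms survive in the difference.\<close>

lemma twisted_sum_real_coeff: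
  assumes "z1 * u1 + z2 * u2 + z3 * u3 = (0 :: complex)"
    and "norm z1 = 1" "norm z2 = 1" "norm z3 = 1" "cnj u1 = u1" "cnj u2 = u3" "u1 \<noteq> 0"
  shows "z1 ^ 2 = z2 * z3"
proof -
  have inv: "z * cnj z = 1" if "norm z = 1" for z
    using that by (simp add: complex_norm_square[symmetric])
  have "cnj u3 = u2" using assms(6) by (metis complex_cnj_cnj)
  then have c: "cnj z1 * u1 + cnj z2 * u3 + cnj z3 * u2 = 0"
    using arg_cong[OF assms(1), of cnj] assms(5,6) by simp
  have "z1 * z2 * z3 * (cnj z1 * u1 + cnj z2 * u3 + cnj z3 * u2)
      = (z1 * cnj z1) * (z2 * z3 * u1) + (z2 * cnj z2) * (z1 * z3 * u3) + (z3 * cnj z3) * (z1 * z2 * u2)"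
    by (simp only: algebra_simps)
  also have "\<dots> = z2 * z3 * u1 + z1 * z3 * u3 + z1 * z2 * u2"
    using inv assms(2-4) by simp
  finally have "u1 * (z2 * z3 - z1 ^ 2) = z1 * z2 * z3 * (cnj z1 * u1 + cnj z2 * u3 + cnj z3 * u2)
      - z1 * (z1 * u1 + z2 * u2 + z3 * u3)"
    by (simp add: algebra_simps power2_eq_square)
  then have "u1 * (z2 * z3 - z1 ^ 2) = 0" using c assms(1) by simp
  then show ?thesis using assms(7) by simp
qed

lemma twisted_sum_imp_lucas:
  assumes "z1 * u1 + z2 * u2 + z3 * u3 = (0 :: complex)" "z1 ^ 2 = z2 * z3"
    and "z1 ^ N = 1" "z2 ^ N = 1" "z3 ^ N = 1" "N > 0"
  shows "lucas_V (u2 + u3) (u2 * u3) N = lucas_V (- u1) (u2 * u3) N"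
proof -
  have "z1 \<noteq> 0" using assms(3,6) by (auto simp: power_0_left)
  \<comment> \<open>By \<open>z1 ^ 2 = z2 * z3\<close> the numbers \<open>z2 / z1\<close> and
    \<open>z3 / z1\<close> are mutually inverse.\<close>
  define a b where "a = z2 * u2 / z1" "b = z3 * u3 / z1"
  have "a + b = - u1"
  proof -
    have "z2 * u2 + z3 * u3 = - (z1 * u1)"
      using assms(1) by (simp add: eq_neg_iff_add_eq_0 add_ac)
    then show ?thesis using \<open>z1 \<noteq> 0\<close> by (simp add: a_b_def flip: add_divide_distrib)
  qed
  moreover have "a * b = u2 * u3"
  proof -
    have "a * b = (z2 * z3) * (u2 * u3) / z1 ^ 2" by (simp add: a_b_def power2_eq_square)
    then show ?thesis using \<open>z1 \<noteq> 0\<close> by (simp flip: assms(2))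
  qed
  moreover have "a ^ N = u2 ^ N" "b ^ N = u3 ^ N"
    using assms by (simp_all add: a_b_def power_mult_distrib power_divide)
  ultimately show ?thesis
    using lucas_V_roots[of a b N] lucas_V_roots[of u2 u3 N] by simp
qed

text \<open>The converse elimination, with \<open>u2\<close> singled out: the \<open>N\<close>-th
  powers of the roots of \<open>t ^ 2 + u2 * t + u1 * u3\<close> have the same sum and product as
  \<open>u1 ^ N\<close> and \<open>u3 ^ N\<close>, so one root is \<open>u1\<close> times an
  \<open>N\<close>-th root of unity.\<close>

lemma lucas_imp_twisted_sum:
  assumes "lucas_V (u1 + u3) (u1 * u3) N = lucas_V (- u2) (u1 * u3) N" "u1 \<noteq> 0" "u3 \<noteq> 0" "N > 0"
  obtains z where "z ^ N = 1" "z * u1 + u2 + u3 / z = (0 :: complex)"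
proof -
  define d where "d = csqrt (u2 ^ 2 - 4 * (u1 * u3))"
  define a b where "a = (- u2 + d) / 2" "b = (- u2 - d) / 2"
  have dd: "d ^ 2 = u2 ^ 2 - 4 * (u1 * u3)" by (simp add: d_def)
  have sum: "a + b = - u2" and prd: "a * b = u1 * u3"
    unfolding a_b_def using dd by (simp_all add: field_simps power2_eq_square)
  have "a ^ N + b ^ N = u1 ^ N + u3 ^ N"
    using assms(1) lucas_V_roots[of a b N] lucas_V_roots[of u1 u3 N] by (simp add: sum prd)
  moreover have "a ^ N * b ^ N = u1 ^ N * u3 ^ N"
    by (simp add: prd flip: power_mult_distrib)
  moreover have "(a ^ N - u1 ^ N) * (b ^ N - u1 ^ N)
      = a ^ N * b ^ N - u1 ^ N * (a ^ N + b ^ N) + u1 ^ N * u1 ^ N"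
    by (simp only: algebra_simps)
  ultimately have "(a ^ N - u1 ^ N) * (b ^ N - u1 ^ N) = 0"
    by (simp add: algebra_simps)
  then have "a ^ N = u1 ^ N \<or> b ^ N = u1 ^ N" by simp
  moreover have "\<exists>z. z ^ N = 1 \<and> z * u1 + u2 + u3 / z = 0" if "\<alpha> ^ N = u1 ^ N" "\<alpha> + \<beta> = - u2" "\<alpha> * \<beta> = u1 * u3" for \<alpha> \<beta>
  proof (intro exI[of _ "\<alpha> / u1"] conjI)
    have "\<alpha> \<noteq> 0" using that(3) assms by auto
    show "(\<alpha> / u1) ^ N = 1" using that(1) assms(2) by (simp add: power_divide)
    have "u3 / (\<alpha> / u1) = \<beta>" using that(3) \<open>\<alpha> \<noteq> 0\<close> assms(2) by (simp add: field_simps)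
    then show "\<alpha> / u1 * u1 + u2 + u3 / (\<alpha> / u1) = 0"
      using that(2) assms(2) by (simp add: eq_neg_iff_add_eq_0 add_ac)
  qed
  ultimately show thesis using sum prd that by (metis add.commute mult.commute)
qed


section \<open>Arithmetic of the roots of the characteristic cubic\<close>

definition cubic_root :: "complex \<Rightarrow> bool" where
  "cubic_root x \<longleftrightarrow> x ^ 3 = x ^ 2 + x + 1"

lemma cubic_root_nonzero: "cubic_root x \<Longrightarrow> x \<noteq> 0"
  by (auto simp: cubic_root_def)

lemma tribseq_powi:
  assumes "cubic_root x"
  shows "tribseq (\<lambda>n. x powi (n + k))"
  unfolding tribseq_def
proof
  fix n
  have eq: "x powi (n + j + k) = x powi (n + k) * x ^ nat j" if "j \<ge> 0" for j
    using cubic_root_nonzero[OF assms] that power_int_add[of x "n + k" j]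
    by (simp add: power_int_def add_ac)
  show "x powi (n + 3 + k) = x powi (n + 2 + k) + x powi (n + 1 + k) + x powi (n + k)"
    using eq[of 1] eq[of 2] eq[of 3] assms by (simp add: cubic_root_def distrib_left)
qed

text \<open>Coordinates of all powers, negative ones included, in the basis 1, \<open>x\<close>,
  \<open>x ^ 2\<close>; through them periods of \<open>T\<close> become congruences for powers of
  \<open>x\<close>.\<close>

lemma powi_eq_trib:
  assumes "cubic_root x"
  shows "x powi n = of_int (T (n - 1)) * x ^ 2 + of_int (T n - T (n - 1)) * x + of_int (T (n - 2))"
proof (rule tribseq_eqI[of "\<lambda>n. x powi n" "\<lambda>n. of_int (T (n - 1)) * x ^ 2 +
    of_int (T n - T (n - 1)) * x + of_int (T (n - 2))"])
  have s: "tribseq (\<lambda>n. of_int (T (n + k)) :: complex)" for k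
    using tribseq_shift[OF tribseq_T, of k] .
  show "tribseq (\<lambda>n. x powi n)" using tribseq_powi[OF assms, of 0] by simp
  have "tribseq (\<lambda>n. x ^ 2 * of_int (T (n - 1)) + x * (of_int (T n) - of_int (T (n - 1)))
      + of_int (T (n - 2)))"
    using s[of "-1"] s[of "-2"] s[of 0]
    by (intro tribseq_add tribseq_diff tribseq_scale) simp_all
  then show "tribseq (\<lambda>n. of_int (T (n - 1)) * x ^ 2 + of_int (T n - T (n - 1)) * x + of_int (T (n - 2)))"
    by (simp add: mult.commute)
  have "T (-1) = 0" "T (-2) = 1"
    using T_rec[of "-1"] T_rec[of "-2"] by (simp_all add: T_0 T_1 T_2)
  then show "x powi 0 = of_int (T (0 - 1)) * x ^ 2 + of_int (T 0 - T (0 - 1)) * x + of_int (T (0 - 2))"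
    "x powi 1 = of_int (T (1 - 1)) * x ^ 2 + of_int (T 1 - T (1 - 1)) * x + of_int (T (1 - 2))"
    "x powi 2 = of_int (T (2 - 1)) * x ^ 2 + of_int (T 2 - T (2 - 1)) * x + of_int (T (2 - 2))"
    by (simp_all add: T_0 T_1 T_2)
qed

lemma cubic_root_algebraic_int:
  assumes "cubic_root x"
  shows "algebraic_int x"
proof (rule algebraic_int.intros[of "[:-1, -1, -1, 1:]"])
  show "\<forall>i. coeff [:- 1, - 1, - 1, 1 :: complex:] i \<in> \<int>"
    by (auto simp: coeff_pCons split: nat.splits)
  show "poly [:- 1, - 1, - 1, 1:] x = 0"
    using assms by (simp add: cubic_root_def power2_eq_square power3_eq_cube algebra_simps)
qed simp

lemma algebraic_int_powi:
  assumes "cubic_root x"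
  shows "algebraic_int (x powi n)"
  unfolding powi_eq_trib[OF assms]
  by (intro algebraic_int_add algebraic_int_mult algebraic_int_power algebraic_int_of_int
      cubic_root_algebraic_int assms)

lemma acong_powi_period:
  assumes "cubic_root x" "trib_period q L" "q \<noteq> 0"
  shows "acong (of_int q) (x powi L) 1"
proof -
  have *: "\<exists>k. T (L + m) - T m = q * k" for m
    using assms(2) unfolding trib_period_def dvd_def by (metis add.commute)
  obtain a b c where abc: "T (L + -1) - T (-1) = q * a" "T (L + 0) - T 0 = q * b"
    "T (L + -2) - T (-2) = q * c" using * by metis
  have v: "T (-1) = 0" "T (-2) = 1"
    using T_rec[of "-1"] T_rec[of "-2"] by (simp_all add: T_0 T_1 T_2)
  have "T (L - 1) = q * a" "T L = q * b" "T (L - 2) = q * c + 1"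
    using abc by (simp_all add: v T_0)
  then have "x powi L - 1 = of_int q * (of_int a * x ^ 2 + of_int (b - a) * x + of_int c)"
    unfolding powi_eq_trib[OF assms(1)] by (simp add: algebra_simps)
  then have "(x powi L - 1) / of_int q = of_int a * x ^ 2 + of_int (b - a) * x + of_int c"
    using assms(3) by simp
  moreover have "algebraic_int (of_int a * x ^ 2 + of_int (b - a) * x + of_int c)"
    by (intro algebraic_int_add algebraic_int_mult algebraic_int_power algebraic_int_of_int
      cubic_root_algebraic_int assms)
  ultimately show ?thesis by (simp only: acong_def)
qed

lemma cubic_root_irrational:
  assumes "cubic_root x"
  shows "x \<notin> \<rat>"
proof
  assume "x \<in> \<rat>"
  with rational_algebraic_int_is_int[OF cubic_root_algebraic_int[OF assms]]
  have "x \<in> \<int>" by simp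
  then obtain k where "x = of_int k" by (auto elim: Ints_cases)
  with assms have "of_int (k ^ 3) = (of_int (k ^ 2 + k + 1) :: complex)"
    by (simp add: cubic_root_def)
  then have k: "k ^ 3 = k ^ 2 + k + 1" by (simp only: of_int_eq_iff)
  then have "k * (k ^ 2 - k - 1) = 1" by (simp add: power2_eq_square power3_eq_cube algebra_simps)
  then have "k dvd 1" by (metis dvd_triv_left)
  then have "k = 1 \<or> k = -1" by auto
  with k show False by auto
qed

lemma cubic_root_independent:
  fixes a b c :: int
  assumes "cubic_root x" and eq: "of_int a + of_int b * x + of_int c * x ^ 2 = 0"
  shows "a = 0 \<and> b = 0 \<and> c = 0"
proof -
  have lin: "d = 0 \<and> e = 0" if "of_int d + of_int e * x = 0" for d e :: int
  proof (cases "e = 0")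
    case False
    then have "x = - of_int d / of_int e"
      using that by (simp add: field_simps eq_neg_iff_add_eq_0)
    moreover have "- of_int d / of_int e \<in> (\<rat> :: complex set)" by simp
    ultimately show ?thesis using cubic_root_irrational[OF assms(1)] by simp
  qed (use that in simp)
  show ?thesis
  proof (cases "c = 0")
    case True
    then show ?thesis using lin[of a b] eq by simp
  next
    case False
    have cub: "x ^ 3 = x ^ 2 + x + 1" using assms(1) by (simp add: cubic_root_def)
    \<comment> \<open>Pseudo-division of the cubic by the supposed quadratic relation. The remainder
      is linear in the irrational number \<open>x\<close>, so both of its coefficients
      vanish.\<close>
    have "of_int (a * b + a * c - c ^ 2) + of_int (b ^ 2 - a * c + b * c - c ^ 2) * x =
      of_int c ^ 2 * (x ^ 3 - x ^ 2 - x - 1)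
      - (of_int c * x - of_int b - of_int c) * (of_int a + of_int b * x + of_int c * x ^ 2)"
      by (simp add: power2_eq_square power3_eq_cube algebra_simps)
    then have "of_int (a * b + a * c - c ^ 2) + of_int (b ^ 2 - a * c + b * c - c ^ 2) * x = 0"
      using eq cub by simp
    from lin[OF this] have "a * b + a * c - c ^ 2 = 0" "b ^ 2 - a * c + b * c - c ^ 2 = 0" by auto
    then have 1: "a * (b + c) = c ^ 2" and 2: "b * (b + c) = c * (a + c)"
      by (simp_all add: power2_eq_square algebra_simps)
    from 1 False have "a \<noteq> 0" by auto
    have "c * (b * c) = b * (a * (b + c))" by (simp add: 1 power2_eq_square)
    also have "\<dots> = c * (a * (a + c))" using 2 by (metis mult.left_commute)
    finally have 3: "b * c = a * (a + c)" using False by simp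
    have "c ^ 3 = c * (a * (b + c))" by (simp add: 1 power2_eq_square power3_eq_cube)
    also have "\<dots> = a * (b * c + c ^ 2)" by (simp add: power2_eq_square algebra_simps)
    also have "\<dots> = a * c ^ 2 + a ^ 2 * c + a ^ 3"
      unfolding 3 by (simp add: power2_eq_square power3_eq_cube algebra_simps)
    \<comment> \<open>This equation makes \<open>c / a\<close> a rational root of the cubic.\<close>
    finally have "of_int (c ^ 3) = (of_int (a * c ^ 2 + a ^ 2 * c + a ^ 3) :: complex)" by simp
    then have "cubic_root (of_int c / of_int a)"
      using \<open>a \<noteq> 0\<close> unfolding cubic_root_def
      by (simp add: field_simps power2_eq_square power3_eq_cube)
    from cubic_root_irrational[OF this] show ?thesis by simp
  qed
qed

text \<open>
  Functions on the three roots that come from an element of \<open>\<int>[\<lambda>]\<close>. Vanishing at one root forces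
  vanishing at all of them; this is all the Galois theory that is needed.
\<close>

definition root_fun :: "(complex \<Rightarrow> complex) \<Rightarrow> bool" where
  "root_fun g \<longleftrightarrow> (\<exists>a b c :: int. \<forall>x. cubic_root x \<longrightarrow> g x = of_int a + of_int b * x + of_int c * x ^ 2)"

lemma root_funI:
  "(\<And>x. cubic_root x \<Longrightarrow> g x = of_int a + of_int b * x + of_int c * x ^ 2) \<Longrightarrow> root_fun g"
  unfolding root_fun_def by blast

lemma root_fun_of_int: "root_fun (\<lambda>_. of_int k)"
  by (rule root_funI[of _ k 0 0]) simp

lemma root_fun_diff:
  assumes "root_fun g" "root_fun h"
  shows "root_fun (\<lambda>x. g x - h x)"
proof -
  obtain a b c a' b' c' :: int
    where "\<And>x. cubic_root x \<Longrightarrow> g x = of_int a + of_int b * x + of_int c * x ^ 2"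
      "\<And>x. cubic_root x \<Longrightarrow> h x = of_int a' + of_int b' * x + of_int c' * x ^ 2"
    using assms unfolding root_fun_def by blast
  then show ?thesis
    by (intro root_funI[of _ "a - a'" "b - b'" "c - c'"]) (simp add: algebra_simps)
qed

lemma root_fun_mult:
  assumes "root_fun g" "root_fun h"
  shows "root_fun (\<lambda>x. g x * h x)"
proof -
  obtain a b c a' b' c' :: int
    where gh: "\<And>x. cubic_root x \<Longrightarrow> g x = of_int a + of_int b * x + of_int c * x ^ 2"
      "\<And>x. cubic_root x \<Longrightarrow> h x = of_int a' + of_int b' * x + of_int c' * x ^ 2"
    using assms unfolding root_fun_def by blast
  show ?thesis
  proof (rule root_funI)
    fix x assume x: "cubic_root x"
    then have x3: "x ^ 3 = x ^ 2 + x + 1" by (simp add: cubic_root_def)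
    have "x ^ 4 = x * x ^ 3" by (simp add: power_numeral_reduce)
    also have "\<dots> = x * (x ^ 2 + x + 1)" by (simp only: x3)
    also have "\<dots> = x ^ 3 + x ^ 2 + x" by (simp add: power_numeral_reduce algebra_simps)
    finally have x4: "x ^ 4 = 2 * x ^ 2 + 2 * x + 1" by (simp add: x3)
    have "g x * h x = of_int (a * a') + of_int (a * b' + b * a') * x
        + of_int (a * c' + b * b' + c * a') * x ^ 2 + of_int (b * c' + c * b') * x ^ 3
        + of_int (c * c') * x ^ 4"
      by (simp add: gh[OF x] power_numeral_reduce algebra_simps)
    also have "\<dots> = of_int (a * a' + (b * c' + c * b') + c * c')
        + of_int (a * b' + b * a' + (b * c' + c * b') + 2 * (c * c')) * x
        + of_int (a * c' + b * b' + c * a' + (b * c' + c * b') + 2 * (c * c')) * x ^ 2"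
      unfolding x3 x4 by (simp add: algebra_simps)
    finally show "g x * h x = of_int (a * a' + (b * c' + c * b') + c * c')
        + of_int (a * b' + b * a' + (b * c' + c * b') + 2 * (c * c')) * x
        + of_int (a * c' + b * b' + c * a' + (b * c' + c * b') + 2 * (c * c')) * x ^ 2" .
  qed
qed

lemma root_fun_powi: "root_fun (\<lambda>x. x powi n)"
  by (rule root_funI[of _ "T (n - 2)" "T n - T (n - 1)" "T (n - 1)"]) (simp add: powi_eq_trib)

lemma root_fun_lucas_V:
  assumes "root_fun f" "root_fun g"
  shows "root_fun (\<lambda>x. lucas_V (f x) (g x) n)"
proof (induction n rule: induct_nat_012)
  case 0
  then show ?case using root_fun_of_int[of 2] by simp
qed (auto intro!: root_fun_diff root_fun_mult assms)

lemma root_fun_conjugate: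
  assumes "root_fun g" "cubic_root x" "g x = 0" "cubic_root y"
  shows "g y = 0"
  using assms cubic_root_independent[OF assms(2)] unfolding root_fun_def by fastforce

section \<open>Integral p-adic zeros\<close>

text \<open>
  At the roots of \<open>f = x\<^sup>3 - x\<^sup>2 - x - 1\<close> this is \<open>22 / f'\<close>, so that \<open>22 T(n) = \<Sum>\<^sub>\<lambda> binet_num \<lambda> \<cdot> \<lambda>\<^bsup>n+1\<^esup>\<close>.
\<close>

definition binet_num :: "complex \<Rightarrow> complex" where
  "binet_num x = 1 + 9 * x - 4 * x ^ 2"

definition binet_term :: "int \<Rightarrow> complex \<Rightarrow> complex" where
  "binet_term n x = binet_num x * x powi (n + 1)"

definition cubic_deriv :: "complex \<Rightarrow> complex" where
  "cubic_deriv x = 3 * x ^ 2 - 2 * x - 1"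

lemma root_fun_binet_term: "root_fun (binet_term n)"
proof -
  have "root_fun binet_num"
    by (rule root_funI[of _ 1 9 "-4"]) (simp add: binet_num_def)
  then show ?thesis
    unfolding binet_term_def using root_fun_mult[OF _ root_fun_powi] by blast
qed

lemma root_fun_cubic_deriv: "root_fun cubic_deriv"
  by (rule root_funI[of _ "-1" "-2" 3]) (simp add: cubic_deriv_def)

lemma algebraic_int_binet_term:
  assumes "cubic_root x"
  shows "algebraic_int (binet_term n x)"
proof -
  have "binet_num x = of_int 1 + of_int 9 * x - of_int 4 * x ^ 2" by (simp add: binet_num_def)
  also have "algebraic_int \<dots>"
    by (intro algebraic_int_add algebraic_int_diff algebraic_int_mult algebraic_int_power
        algebraic_int_of_int cubic_root_algebraic_int assms)
  finally show ?thesis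
    unfolding binet_term_def by (intro algebraic_int_mult algebraic_int_powi assms)
qed

lemma binet_num_nonzero:
  assumes "cubic_root x"
  shows "binet_num x \<noteq> 0"
  using cubic_root_independent[OF assms, of 1 9 "-4"] by (auto simp: binet_num_def)

lemma binet_term_nonzero: "cubic_root x \<Longrightarrow> binet_term n x \<noteq> 0"
  using binet_num_nonzero cubic_root_nonzero by (auto simp: binet_term_def)

lemma binet_term_add:
  assumes "cubic_root x"
  shows "binet_term (a + d) x = binet_term a x * x powi d"
  using power_int_add[of x "a + 1" d] cubic_root_nonzero[OF assms]
  by (simp add: binet_term_def algebra_simps)

text \<open>The \<open>N\<close>-th power turns \<open>n - a\<close> into
  \<open>N * (n - a)\<close>, a multiple of the period \<open>N * p ^ j\<close>; the corresponding
  power of \<open>x\<close> is congruent to 1.\<close>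

lemma acong_binet_term:
  assumes "cubic_root x" "trib_period (int p) (int N)" "odd p" "int p ^ j dvd n - a"
  shows "acong (of_int (int p ^ j)) (binet_term n x ^ N) (binet_term a x ^ N)"
proof -
  have "p \<noteq> 0" using assms(3) by presburger
  obtain c where c: "n - a = int p ^ j * c" using assms(4) by blast
  have "trib_period (int p ^ (j + 1)) (c * (int N * int p ^ j))"
    using trib_lift[OF assms(2,3)] trib_period_mult by blast
  then have "trib_period (int p ^ j) (int N * (n - a))"
    unfolding trib_period_def c by (metis (no_types, lifting) dvd_trans le_imp_power_dvd le_add1
        mult.assoc mult.commute)
  then have 1: "acong (of_int (int p ^ j)) (x powi (int N * (n - a))) 1"
    using \<open>p \<noteq> 0\<close> by (intro acong_powi_period assms) auto
  have "binet_term n x ^ N = binet_term a x ^ N * x powi (int N * (n - a))"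
    using binet_term_add[OF assms(1), of a "n - a"]
    by (simp add: power_mult_distrib power_int_power' mult.commute)
  moreover have "acong (of_int (int p ^ j)) (binet_term a x ^ N * x powi (int N * (n - a)))
      (binet_term a x ^ N * 1)"
    by (intro acong_mult acong_refl 1 algebraic_int_power algebraic_int_binet_term assms) auto
  ultimately show ?thesis by simp
qed

locale tribonacci_roots =
  fixes x1 x2 x3 :: complex
  assumes e1: "x1 + x2 + x3 = 1"
    and e2: "x1 * x2 + x1 * x3 + x2 * x3 = - 1"
    and e3: "x1 * x2 * x3 = 1"
    and real_root: "cnj x1 = x1"
    and conj_roots: "cnj x2 = x3"

text \<open>A real root \<open>r\<close> in [1, 2] comes from the intermediate value theorem. The
  other two have sum \<open>1 - r\<close> and product \<open>1 / r\<close>, and they are conjugate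
  because \<open>((1 - r) / 2) ^ 2 \<le> 1 / 4\<close> and \<open>1 / r \<ge> 1 / 2\<close>.\<close>

lemma tribonacci_roots_exist: "\<exists>x1 x2 x3. tribonacci_roots x1 x2 x3"
proof -
  have "\<exists>r. 1 \<le> r \<and> r \<le> 2 \<and> r ^ 3 - r ^ 2 - r - 1 = (0 :: real)"
    by (rule IVT') (auto intro!: continuous_intros)
  then obtain r :: real where r: "1 \<le> r" "r \<le> 2" "r ^ 3 - r ^ 2 - r - 1 = 0" by blast
  define m where "m = sqrt (1 / r - ((1 - r) / 2) ^ 2)"
  have "((1 - r) / 2) ^ 2 \<le> (1 / 2) ^ 2" using r by (subst abs_le_square_iff[symmetric]) auto
  moreover have "1 / 2 \<le> 1 / r" using r by (simp add: field_simps)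
  ultimately have m: "m ^ 2 = 1 / r - ((1 - r) / 2) ^ 2"
    unfolding m_def by (subst real_sqrt_pow2) (auto simp: power2_eq_square)
  define x where "x = Complex ((1 - r) / 2) m"
  have sum: "x + cnj x = of_real (1 - r)" by (simp add: x_def complex_eq_iff)
  have prd: "x * cnj x = of_real (1 / r)"
    using m by (simp add: x_def complex_eq_iff power2_eq_square)
  have "tribonacci_roots (of_real r) x (cnj x)"
  proof
    show "of_real r + x + cnj x = 1" using sum by (simp add: add.assoc)
    have "r * (1 - r) + 1 / r = - 1"
      using r by (simp add: field_simps power2_eq_square power3_eq_cube)
    then have "of_real (r * (1 - r) + 1 / r) = (- 1 :: complex)"
      by (metis of_real_1 of_real_minus)
    then show "of_real r * x + of_real r * cnj x + x * cnj x = - 1"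
      unfolding prd distrib_left[symmetric] sum by simp
    show "of_real r * x * cnj x = 1"
      using prd r by (simp add: mult.assoc)
  qed simp_all
  then show ?thesis by blast
qed

lemma cubic_root_if_symmetric:
  fixes x y z :: complex
  assumes "x + y + z = 1" "x * y + x * z + y * z = - 1" "x * y * z = 1"
  shows "cubic_root x"
proof -
  have "x ^ 3 - (x + y + z) * x ^ 2 + (x * y + x * z + y * z) * x - x * y * z = 0"
    by (simp add: power2_eq_square power3_eq_cube algebra_simps)
  then show ?thesis unfolding assms by (simp add: cubic_root_def algebra_simps)
qed

text \<open>The product of f' over the three roots is 44, whence the factor 22 * 22 / 44 = 11, and
  \<open>y * z = 1 / x\<close>. The right side involves \<open>x\<close> alone, as the passage to
  another root requires.\<close>

lemma binet_term_prod:
  fixes x y z :: complex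
  assumes "x + y + z = 1" "x * y + x * z + y * z = - 1" "x * y * z = 1"
  shows "binet_term n y * binet_term n z = 11 * cubic_deriv x * x powi (- n - 1)"
proof -
  have cub: "cubic_root x" by (rule cubic_root_if_symmetric[OF assms])
  then have x3: "x ^ 3 = x ^ 2 + x + 1" by (simp add: cubic_root_def)
  have "x ^ 4 = x * x ^ 3" by (simp add: power_numeral_reduce)
  also have "\<dots> = x * (x ^ 2 + x + 1)" by (simp only: x3)
  also have "\<dots> = x ^ 3 + x ^ 2 + x" by (simp add: power_numeral_reduce algebra_simps)
  finally have x4: "x ^ 4 = 2 * x ^ 2 + 2 * x + 1" by (simp add: x3)
  have S: "y + z = 1 - x" using assms(1) by (simp add: algebra_simps)
  have "y * z = - 1 - x * (y + z)" using assms(2) by (simp add: algebra_simps)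
  then have P: "y * z = x ^ 2 - x - 1" unfolding S by (simp add: power2_eq_square algebra_simps)
  have "binet_num y * binet_num z = 1 + 9 * (y + z) - 4 * ((y + z) ^ 2 - 2 * (y * z))
      + 81 * (y * z) - 36 * (y * z) * (y + z) + 16 * (y * z) ^ 2"
    by (simp add: binet_num_def power_numeral_reduce algebra_simps)
  also have "\<dots> = 16 * x ^ 4 + 4 * x ^ 3 - 3 * x ^ 2 - 58 * x - 31"
    unfolding S P by (simp add: power_numeral_reduce algebra_simps)
  also have "\<dots> = 11 * cubic_deriv x"
    unfolding x3 x4 cubic_deriv_def by simp
  finally have num: "binet_num y * binet_num z = 11 * cubic_deriv x" .
  have "y * z = inverse x"
    using assms(3) by (metis inverse_unique mult.assoc)
  then have "y powi (n + 1) * z powi (n + 1) = x powi (- n - 1)"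
    by (simp flip: power_int_mult_distrib add: power_int_inverse power_int_minus[symmetric])
  then show ?thesis
    using num by (simp add: binet_term_def algebra_simps)
qed

context tribonacci_roots
begin

lemma cub: "cubic_root x1" "cubic_root x2" "cubic_root x3"
  using cubic_root_if_symmetric[of x1 x2 x3] cubic_root_if_symmetric[of x2 x1 x3]
    cubic_root_if_symmetric[of x3 x1 x2] e1 e2 e3 by (simp_all add: algebra_simps)

lemma power_sums:
  "x1 ^ 2 + x2 ^ 2 + x3 ^ 2 = 3" "x1 ^ 3 + x2 ^ 3 + x3 ^ 3 = 7"
  "x1 ^ 4 + x2 ^ 4 + x3 ^ 4 = 11" "x1 ^ 5 + x2 ^ 5 + x3 ^ 5 = 21"
proof -
  have rec: "x ^ 3 = x ^ 2 + x + 1" "x ^ 4 = x ^ 3 + x ^ 2 + x" "x ^ 5 = x ^ 4 + x ^ 3 + x ^ 2"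
    if "cubic_root x" for x
  proof -
    show x3: "x ^ 3 = x ^ 2 + x + 1" using that by (simp add: cubic_root_def)
    have "x ^ 4 = x * x ^ 3" by (simp add: power_numeral_reduce)
    also have "\<dots> = x * (x ^ 2 + x + 1)" by (simp only: x3)
    finally show "x ^ 4 = x ^ 3 + x ^ 2 + x" by (simp add: power_numeral_reduce algebra_simps)
    have "x ^ 5 = x ^ 2 * x ^ 3" by (simp add: power_numeral_reduce)
    also have "\<dots> = x ^ 2 * (x ^ 2 + x + 1)" by (simp only: x3)
    finally show "x ^ 5 = x ^ 4 + x ^ 3 + x ^ 2" by (simp add: power_numeral_reduce algebra_simps)
  qed
  have "x1 ^ 2 + x2 ^ 2 + x3 ^ 2 = (x1 + x2 + x3) ^ 2 - 2 * (x1 * x2 + x1 * x3 + x2 * x3)"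
    by (simp add: power2_eq_square algebra_simps)
  then show s2: "x1 ^ 2 + x2 ^ 2 + x3 ^ 2 = 3" unfolding e1 e2 by simp
  have "x1 ^ 3 + x2 ^ 3 + x3 ^ 3 = (x1 ^ 2 + x2 ^ 2 + x3 ^ 2) + (x1 + x2 + x3) + 3"
    unfolding rec(1)[OF cub(1)] rec(1)[OF cub(2)] rec(1)[OF cub(3)] by simp
  then show s3: "x1 ^ 3 + x2 ^ 3 + x3 ^ 3 = 7" unfolding s2 e1 by simp
  have "x1 ^ 4 + x2 ^ 4 + x3 ^ 4 = (x1 ^ 3 + x2 ^ 3 + x3 ^ 3) + (x1 ^ 2 + x2 ^ 2 + x3 ^ 2) + (x1 + x2 + x3)"
    unfolding rec(2)[OF cub(1)] rec(2)[OF cub(2)] rec(2)[OF cub(3)] by simp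
  then show s4: "x1 ^ 4 + x2 ^ 4 + x3 ^ 4 = 11" unfolding s3 s2 e1 by simp
  have "x1 ^ 5 + x2 ^ 5 + x3 ^ 5 = (x1 ^ 4 + x2 ^ 4 + x3 ^ 4) + (x1 ^ 3 + x2 ^ 3 + x3 ^ 3)
      + (x1 ^ 2 + x2 ^ 2 + x3 ^ 2)"
    unfolding rec(3)[OF cub(1)] rec(3)[OF cub(2)] rec(3)[OF cub(3)] by simp
  then show "x1 ^ 5 + x2 ^ 5 + x3 ^ 5 = 21" unfolding s4 s3 s2 by simp
qed

lemma binet: "binet_term n x1 + binet_term n x2 + binet_term n x3 = 22 * of_int (T n)"
proof -
  define V where "V n = binet_term n x1 + binet_term n x2 + binet_term n x3" for n
  have tV: "tribseq V"
    unfolding V_def binet_term_def by (intro tribseq_add tribseq_scale tribseq_powi cub)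
  have "V 0 = (x1 + x2 + x3) + 9 * (x1 ^ 2 + x2 ^ 2 + x3 ^ 2) - 4 * (x1 ^ 3 + x2 ^ 3 + x3 ^ 3)"
    by (simp add: V_def binet_term_def binet_num_def power_numeral_reduce algebra_simps)
  then have V0: "V 0 = 22 * of_int (T 0)" by (simp add: power_sums e1 T_0)
  have "V 1 = (x1 ^ 2 + x2 ^ 2 + x3 ^ 2) + 9 * (x1 ^ 3 + x2 ^ 3 + x3 ^ 3)
      - 4 * (x1 ^ 4 + x2 ^ 4 + x3 ^ 4)"
    by (simp add: V_def binet_term_def binet_num_def power_numeral_reduce algebra_simps)
  then have V1: "V 1 = 22 * of_int (T 1)" by (simp add: power_sums T_1)
  have "V 2 = (x1 ^ 3 + x2 ^ 3 + x3 ^ 3) + 9 * (x1 ^ 4 + x2 ^ 4 + x3 ^ 4)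
      - 4 * (x1 ^ 5 + x2 ^ 5 + x3 ^ 5)"
    by (simp add: V_def binet_term_def binet_num_def power_numeral_reduce algebra_simps)
  then have V2: "V 2 = 22 * of_int (T 2)" by (simp add: power_sums T_2)
  have "V n = 22 * of_int (T n)"
    by (rule tribseq_eqI[OF tV tribseq_scale[OF tribseq_T]]) (fact V0 V1 V2)+
  then show ?thesis by (simp add: V_def)
qed

text \<open>At \<open>n = - a - 1\<close> and up to the factor 11, this is the second elementary
  symmetric function of the Binet terms at \<open>a\<close>.\<close>

lemma deriv_sum:
  "cubic_deriv x1 * x1 powi n + cubic_deriv x2 * x2 powi n + cubic_deriv x3 * x3 powi n
   = of_int (12 * T n + 6 * T (n + 1) - 2 * T (n + 2))"
proof -
  define V where "V n = cubic_deriv x1 * x1 powi n + cubic_deriv x2 * x2 powi n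
    + cubic_deriv x3 * x3 powi n" for n
  define W where "W n = 12 * T n + 6 * T (n + 1) - 2 * T (n + 2)" for n
  have tp: "tribseq (\<lambda>n. x powi n)" if "cubic_root x" for x
    using tribseq_powi[OF that, of 0] by simp
  have tV: "tribseq V"
    unfolding V_def by (intro tribseq_add tribseq_scale tp[OF cub(1)] tp[OF cub(2)] tp[OF cub(3)])
  have "tribseq W"
    unfolding W_def by (intro tribseq_add tribseq_diff tribseq_scale tribseq_shift tribseq_T_int)
  then have tW: "tribseq (\<lambda>n. of_int (W n) :: complex)" by (simp add: tribseq_def)
  have "T 3 = 2" "T 4 = 4" using T_rec[of 0] T_rec[of 1] by (simp_all add: T_0 T_1 T_2)
  then have W: "W 0 = 4" "W 1 = 14" "W 2 = 16" by (simp_all add: W_def T_0 T_1 T_2)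
  have "V 0 = 3 * (x1 ^ 2 + x2 ^ 2 + x3 ^ 2) - 2 * (x1 + x2 + x3) - 3"
    by (simp add: V_def cubic_deriv_def)
  then have V0: "V 0 = 4" by (simp add: power_sums e1)
  have "V 1 = 3 * (x1 ^ 3 + x2 ^ 3 + x3 ^ 3) - 2 * (x1 ^ 2 + x2 ^ 2 + x3 ^ 2) - (x1 + x2 + x3)"
    by (simp add: V_def cubic_deriv_def power_numeral_reduce algebra_simps)
  then have V1: "V 1 = 14" by (simp add: power_sums e1)
  have "V 2 = 3 * (x1 ^ 4 + x2 ^ 4 + x3 ^ 4) - 2 * (x1 ^ 3 + x2 ^ 3 + x3 ^ 3)
      - (x1 ^ 2 + x2 ^ 2 + x3 ^ 2)"
    by (simp add: V_def cubic_deriv_def power_numeral_reduce algebra_simps)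
  then have V2: "V 2 = 16" by (simp add: power_sums)
  have "V n = of_int (W n)"
    by (rule tribseq_eqI[OF tV tW]) (simp_all add: V0 V1 V2 W)
  then show ?thesis by (simp add: V_def W_def)
qed

text \<open>Modulo \<open>p ^ j\<close> the norm at \<open>a\<close> agrees with the norm at an
  \<open>n\<close> with \<open>p ^ j\<close> dividing \<open>T n\<close>, where one factor is
  \<open>22 * T n\<close>.\<close>

lemma padic_zero_imp_twisted_sum:
  assumes "odd p" "p > 1" "N > 0" "trib_period (int p) (int N)"
    and approx: "\<And>j. \<exists>n. int p ^ j dvd n - a \<and> int p ^ j dvd T n"
  obtains z1 z2 z3 where "z1 ^ N = 1" "z2 ^ N = 1" "z3 ^ N = 1"
    "z1 * binet_term a x1 + z2 * binet_term a x2 + z3 * binet_term a x3 = 0"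
proof -
  define u where "u n = twist_norm N (binet_term n x1) (binet_term n x2) (binet_term n x3)" for n
  note ai = algebraic_int_binet_term[OF cub(1)] algebraic_int_binet_term[OF cub(2)]
    algebraic_int_binet_term[OF cub(3)]
  have div: "algebraic_int (u a / of_int (int p) ^ j)" for j
  proof -
    obtain n where n: "int p ^ j dvd n - a" "int p ^ j dvd T n" using approx by blast
    have "int p ^ j dvd a - n" using n(1) by (simp add: dvd_diff_commute)
    then have "acong (of_int (int p ^ j)) (u a) (u n)"
      unfolding u_def
      by (intro acong_twist_norm acong_binet_term ai cub assms(1,3,4))
    then have 1: "algebraic_int ((u a - u n) / of_int (int p ^ j))" by (simp add: acong_def)
    obtain k where k: "T n = int p ^ j * k" using n(2) by blast
    have "(binet_term n x1 + binet_term n x2 + binet_term n x3) / of_int (int p ^ j) = of_int (22 * k)"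
      using assms(2) by (simp add: binet k)
    then have "algebraic_int ((binet_term n x1 + binet_term n x2 + binet_term n x3) / of_int (int p ^ j))"
      by (simp only: algebraic_int_of_int)
    then have 2: "algebraic_int (u n / of_int (int p ^ j))"
      unfolding u_def by (intro twist_norm_divisible ai assms(3))
    from algebraic_int_add[OF 1 2] show ?thesis by (simp add: diff_divide_distrib)
  qed
  have "u a = 0"
    using assms(2) div div[of 0]
    by (intro algebraic_int_infinitely_divisible_imp_0[of _ "int p"]) auto
  moreover have "finite {z :: complex. z ^ N = 1}" using assms(3) by (intro finite_roots_unity) simp
  ultimately show ?thesis
    using that unfolding u_def twist_norm_def by auto
qed

lemma padic_zero_imp_zero_or_quadratic:
  assumes "odd p" "p > 1" "N > 0" "trib_period (int p) (int N)"
    and approx: "\<And>j. \<exists>n. int p ^ j dvd n - a \<and> int p ^ j dvd T n"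
  shows "T a = 0 \<or> 44 * T a ^ 2 = 3 * (12 * T (- a - 1) + 6 * T (- a) - 2 * T (- a + 1))"
proof -
  define u1 u2 u3 where u: "u1 = binet_term a x1" "u2 = binet_term a x2" "u3 = binet_term a x3"
  have nz: "u1 \<noteq> 0" "u2 \<noteq> 0" "u3 \<noteq> 0" by (simp_all add: u binet_term_nonzero cub)
  have cj: "cnj u1 = u1" "cnj u2 = u3"
    using real_root conj_roots
    by (simp_all add: u binet_term_def binet_num_def complex_cnj_power_int)
  have sum: "u1 + u2 + u3 = 22 * of_int (T a)" by (simp add: u binet)
  define Y where "Y x = 11 * cubic_deriv x * x powi (- a - 1)" for x
  have Y: "u2 * u3 = Y x1" "u1 * u3 = Y x2" "u1 * u2 = Y x3"
    unfolding u Y_def using e1 e2 e3 by (intro binet_term_prod; simp add: algebra_simps)+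
  have norm1: "norm z = 1" if "z ^ N = 1" for z :: complex
    using that assms(3) by (metis norm_one norm_power power_eq_1_iff norm_ge_zero neq0_conv)
  obtain z1 z2 z3 where z: "z1 ^ N = 1" "z2 ^ N = 1" "z3 ^ N = 1"
    "z1 * u1 + z2 * u2 + z3 * u3 = 0"
    using padic_zero_imp_twisted_sum[OF assms] unfolding u by metis
  have "z1 ^ 2 = z2 * z3"
    using twisted_sum_real_coeff[OF z(4)] norm1 z cj nz by simp
  from twisted_sum_imp_lucas[OF z(4) this z(1-3) assms(3)]
  have L1: "lucas_V (u2 + u3) (u2 * u3) N = lucas_V (- u1) (u2 * u3) N" .
  \<comment> \<open>\<open>L1\<close> expressed through \<open>x1\<close> alone, with
    \<open>u2 + u3\<close> replaced by \<open>22 * T a - u1\<close>, so that it can be transported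
    to \<open>x2\<close>.\<close>
  define g where "g x = lucas_V (of_int (22 * T a) - binet_term a x) (Y x) N
    - lucas_V (of_int 0 - binet_term a x) (Y x) N" for x
  have "root_fun (\<lambda>x. of_int 11 * cubic_deriv x * x powi (- a - 1))"
    by (intro root_fun_mult root_fun_of_int root_fun_cubic_deriv root_fun_powi)
  then have "root_fun Y" unfolding Y_def by simp
  then have "root_fun g"
    unfolding g_def
    by (intro root_fun_diff root_fun_lucas_V root_fun_of_int root_fun_binet_term)
  moreover have "u2 + u3 = of_int (22 * T a) - u1" using sum by (simp add: algebra_simps)
  then have "g x1 = 0" using L1 by (simp add: g_def flip: u Y)
  ultimately have "g x2 = 0" using root_fun_conjugate cub by blast
  moreover have "u1 + u3 = of_int (22 * T a) - u2" using sum by (simp add: algebra_simps)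
  ultimately have "lucas_V (u1 + u3) (u1 * u3) N = lucas_V (- u2) (u1 * u3) N"
    by (simp add: g_def flip: u Y)
  then obtain z where zN: "z ^ N = 1" and zs: "z * u1 + u2 + u3 / z = 0"
    using lucas_imp_twisted_sum nz assms(3) by metis
  have "z \<noteq> 0" using zN assms(3) by (auto simp: power_0_left)
  \<comment> \<open>Here the real term \<open>u1\<close> carries \<open>z\<close>, while
    \<open>u2\<close> and \<open>u3\<close> carry 1 and \<open>1 / z\<close>.\<close>
  have "z ^ 2 = 1 * inverse z"
    using zs norm1[OF zN] cj nz
    by (intro twisted_sum_real_coeff[of z u1 1 u2 "inverse z" u3])
      (simp_all add: norm_inverse divide_inverse mult.commute)
  then have z3: "z * z * z = 1" using \<open>z \<noteq> 0\<close> by (simp add: power2_eq_square)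
  then have iz: "u3 / z = z * z * u3" using \<open>z \<noteq> 0\<close> by (simp add: field_simps)
  show ?thesis
  proof (cases "z = 1")
    case True
    then have "T a = 0" using zs sum by simp
    then show ?thesis ..
  next
    case False
    have "(z - 1) * (z * z + z + 1) = z * z * z - 1" by (simp add: algebra_simps)
    then have "(z - 1) * (z * z + z + 1) = 0" using z3 by simp
    then have "z * z + z + 1 = 0" using False by simp
    then have om: "z * z = - 1 - z" by (simp add: eq_diff_eq eq_neg_iff_add_eq_0)
    \<comment> \<open>The vanishing sum times the sum with \<open>z\<close> and \<open>z * z\<close>
      exchanged is the symmetric form \<open>e1 ^ 2 - 3 * e2\<close> in the
      \<open>u\<close>s.\<close>
    have "(z * u1 + u2 + (z * z) * u3) * ((z * z) * u1 + u2 + z * u3) = 0"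
      using zs iz by simp
    also have "(z * u1 + u2 + (z * z) * u3) * ((z * z) * u1 + u2 + z * u3) =
        (z * z * z) * (u1 * u1 + u3 * u3) + u2 * u2 + (z * z + z) * (u1 * u2 + u2 * u3)
        + ((z * z * z) * z + z * z) * (u1 * u3)"
      by (simp add: algebra_simps)
    also have "\<dots> = (u1 + u2 + u3) ^ 2 - 3 * (u1 * u2 + u2 * u3 + u1 * u3)"
      unfolding z3 unfolding om by (simp add: power2_eq_square algebra_simps)
    finally have "(22 * of_int (T a)) ^ 2 = 3 * (Y x1 + Y x2 + Y x3)"
      unfolding sum by (simp add: Y algebra_simps)
    also have "Y x1 + Y x2 + Y x3 = 11 * of_int (12 * T (- a - 1) + 6 * T (- a) - 2 * T (- a + 1))"
    proof -
      have "Y x1 + Y x2 + Y x3 = 11 * (cubic_deriv x1 * x1 powi (- a - 1)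
          + cubic_deriv x2 * x2 powi (- a - 1) + cubic_deriv x3 * x3 powi (- a - 1))"
        by (simp only: Y_def mult.assoc distrib_left)
      also have "- a - 1 + 1 = - a" "- a - 1 + 2 = - a + 1" by simp_all
      with deriv_sum[of "- a - 1"]
      have "cubic_deriv x1 * x1 powi (- a - 1) + cubic_deriv x2 * x2 powi (- a - 1)
          + cubic_deriv x3 * x3 powi (- a - 1)
        = of_int (12 * T (- a - 1) + 6 * T (- a) - 2 * T (- a + 1))"
        by (simp only:)
      finally show ?thesis .
    qed
    finally have "of_int (11 * (44 * T a ^ 2)) =
        (of_int (11 * (3 * (12 * T (- a - 1) + 6 * T (- a) - 2 * T (- a + 1)))) :: complex)"
      by (simp add: power2_eq_square)
    then have "11 * (44 * T a ^ 2) = 11 * (3 * (12 * T (- a - 1) + 6 * T (- a) - 2 * T (- a + 1)))"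
      by (simp only: of_int_eq_iff)
    then show ?thesis by simp
  qed
qed

end

section \<open>Reduction modulo 7\<close>

lemma trib_period_dvd_diff:
  assumes "trib_period q L" "L dvd m - n"
  shows "q dvd T m - T n"
proof -
  obtain w where "m - n = L * w" using assms(2) by (auto simp: dvd_def)
  then have "m = n + w * L" by (simp add: algebra_simps)
  then show ?thesis using trib_period_mult[OF assms(1), of w] by (simp add: trib_period_def)
qed

fun unit_triple :: "int \<Rightarrow> int \<times> int \<times> int \<Rightarrow> bool" where
  "unit_triple p (x, y, z) \<longleftrightarrow> x mod p = 0 \<and> y mod p = 1 \<and> z mod p = 1"

lemma trib_period_if_unit_triple:
  assumes "unit_triple p (trib_mod p N)" "N \<ge> 0" "p > 1"
  shows "trib_period p N"
proof -
  obtain x y z where v: "trib_mod p N = (x, y, z)" by (metis prod_cases3)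
  have 1: "p dvd x" "p dvd y - 1" "p dvd z - 1"
    using assms(1,3) v by (auto simp: mod_eq_0_iff_dvd simp flip: mod_eq_dvd_iff)
  note 2 = trib_mod_correct[OF assms(2) v]
  show ?thesis
    using dvd_add[OF 2(1) 1(1)] dvd_add[OF 2(2) 1(2)] dvd_add[OF 2(3) 1(3)]
    by (intro trib_periodI) simp_all
qed

text \<open>
  The modulus 7 is chosen because 33 is a non-residue modulo 7: up to a square, 33 is the discriminant of
  the binary form \<open>(\<Sum>u)\<^sup>2 - 3 e\<^sub>2(u)\<close> on elements of trace zero, which is therefore anisotropic.
\<close>

fun quadratic_fails_mod_7 :: "int \<times> int \<times> int \<Rightarrow> int \<times> int \<times> int \<Rightarrow> bool" where
  "quadratic_fails_mod_7 (t, _, _) (x, y, z) \<longleftrightarrow> (44 * (t * t) - 3 * (12 * x + 6 * y - 2 * z)) mod 7 \<noteq> 0"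

text \<open>As 48 is a period modulo 7, \<open>i\<close> runs through the residues of
  \<open>a\<close>, and \<open>47 - i\<close> is the residue of \<open>- a - 1\<close>.\<close>

lemma quadratic_fails_mod_7_all:
  "list_all (\<lambda>i. quadratic_fails_mod_7 (trib_mod 7 i) (trib_mod 7 (47 - i))) [0..47]"
  by code_simp

lemma trib_period_7: "trib_period 7 48"
  by (rule trib_period_if_unit_triple) (code_simp, simp_all)

lemma trib_quadratic_impossible:
  "44 * T a ^ 2 \<noteq> 3 * (12 * T (- a - 1) + 6 * T (- a) - 2 * T (- a + 1))"
proof
  assume eq: "44 * T a ^ 2 = 3 * (12 * T (- a - 1) + 6 * T (- a) - 2 * T (- a + 1))"
  define i where "i = a mod 48"
  have i: "0 \<le> i" "i \<le> 47" unfolding i_def by (simp, simp add: pos_mod_bound[of 48 a, simplified] zless_imp_add1_zle)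
  obtain t t' t'' where v: "trib_mod 7 i = (t, t', t'')" by (metis prod_cases3)
  obtain x y z where w: "trib_mod 7 (47 - i) = (x, y, z)" by (metis prod_cases3)
  have d: "48 dvd a - i" unfolding i_def by (simp add: mod_eq_dvd_iff[symmetric])
  have e: "48 dvd (- a - 1) - (47 - i)" "48 dvd - a - (47 - i + 1)" "48 dvd (- a + 1) - (47 - i + 2)"
  proof -
    have "48 dvd - (a - i) - 48" using d by (intro dvd_diff) (simp_all only: dvd_minus_iff dvd_refl)
    moreover have "(- a - 1) - (47 - i) = - (a - i) - 48" "- a - (47 - i + 1) = - (a - i) - 48"
      "(- a + 1) - (47 - i + 2) = - (a - i) - 48" by simp_all
    ultimately show "48 dvd (- a - 1) - (47 - i)" "48 dvd - a - (47 - i + 1)"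
      "48 dvd (- a + 1) - (47 - i + 2)" by (simp_all only:)
  qed
  note tv = trib_mod_correct[OF i(1) v]
  have i': "0 \<le> 47 - i" using i by simp
  note xyz = trib_mod_correct[OF i' w]
  have 1: "7 dvd T a - t"
    using dvd_add[OF trib_period_dvd_diff[OF trib_period_7 d] tv(1)] by simp
  have 2: "7 dvd T (- a - 1) - x" "7 dvd T (- a) - y" "7 dvd T (- a + 1) - z"
    using dvd_add[OF trib_period_dvd_diff[OF trib_period_7 e(1)] xyz(1)]
      dvd_add[OF trib_period_dvd_diff[OF trib_period_7 e(2)] xyz(2)]
      dvd_add[OF trib_period_dvd_diff[OF trib_period_7 e(3)] xyz(3)] by simp_all
  have "7 dvd (44 * (T a * T a) - 3 * (12 * T (- a - 1) + 6 * T (- a) - 2 * T (- a + 1)))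
      - (44 * (t * t) - 3 * (12 * x + 6 * y - 2 * z))"
    by (intro dvd_diff_add dvd_diff_mult dvd_diff_diff 1 2) simp_all
  then have "7 dvd 44 * (t * t) - 3 * (12 * x + 6 * y - 2 * z)"
    using eq by (simp add: power2_eq_square dvd_diff_commute)
  moreover have "quadratic_fails_mod_7 (trib_mod 7 i) (trib_mod 7 (47 - i))"
    using quadratic_fails_mod_7_all i unfolding list_all_iff by simp
  ultimately show False unfolding v w by (simp add: mod_eq_0_iff_dvd)
qed

theorem trib_padic_integer_zero:
  assumes "odd p" "p > 1" "N > 0" "trib_period (int p) (int N)"
    and "\<And>j. \<exists>n. int p ^ j dvd n - a \<and> int p ^ j dvd T n"
  shows "T a = 0"
proof -
  obtain x1 x2 x3 where "tribonacci_roots x1 x2 x3" using tribonacci_roots_exist by blast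
  then interpret tribonacci_roots x1 x2 x3 .
  show ?thesis
    using padic_zero_imp_zero_or_quadratic[OF assms] trib_quadratic_impossible by blast
qed

section \<open>Zeros of the Tribonacci sequence and the primes 83 and 397\<close>

lemma trib_zeros: "T 0 = 0" "T (-1) = 0" "T (-4) = 0" "T (-17) = 0"
proof -
  have t1: "T (-1) = 0" using T_rec[of "-1"] by (simp add: T_2 T_1 T_0)
  have t2: "T (-2) = 1" using T_rec[of "-2"] by (simp add: T_1 T_0 t1)
  have t3: "T (-3) = -1" using T_rec[of "-3"] by (simp add: T_0 t1 t2)
  have t4: "T (-4) = 0" using T_rec[of "-4"] by (simp add: t3 t2 t1)
  have t5: "T (-5) = 2" using T_rec[of "-5"] by (simp add: t4 t3 t2)
  have t6: "T (-6) = -3" using T_rec[of "-6"] by (simp add: t5 t4 t3)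
  have t7: "T (-7) = 1" using T_rec[of "-7"] by (simp add: t6 t5 t4)
  have t8: "T (-8) = 4" using T_rec[of "-8"] by (simp add: t7 t6 t5)
  have t9: "T (-9) = -8" using T_rec[of "-9"] by (simp add: t8 t7 t6)
  have t10: "T (-10) = 5" using T_rec[of "-10"] by (simp add: t9 t8 t7)
  have t11: "T (-11) = 7" using T_rec[of "-11"] by (simp add: t10 t9 t8)
  have t12: "T (-12) = -20" using T_rec[of "-12"] by (simp add: t11 t10 t9)
  have t13: "T (-13) = 18" using T_rec[of "-13"] by (simp add: t12 t11 t10)
  have t14: "T (-14) = 9" using T_rec[of "-14"] by (simp add: t13 t12 t11)
  have t15: "T (-15) = -47" using T_rec[of "-15"] by (simp add: t14 t13 t12)
  have t16: "T (-16) = 56" using T_rec[of "-16"] by (simp add: t15 t14 t13)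
  have t17: "T (-17) = 0" using T_rec[of "-17"] by (simp add: t16 t15 t14)
  show "T 0 = 0" "T (-1) = 0" "T (-4) = 0" "T (-17) = 0" by (fact T_0 t1 t4 t17)+
qed

text \<open>Write \<open>n - a = Q * p ^ k * w\<close> with \<open>w\<close> prime to
  \<open>p\<close>. Then \<open>T n\<close> is \<open>w * p ^ k * T (a + Q)\<close> modulo
  \<open>p ^ (k + 2)\<close>, and \<open>p\<close> divides \<open>T (a + Q)\<close> exactly
  once.\<close>

lemma nu_at_zero_class:
  assumes "prime p" "odd p" "trib_period (int p) Q" "\<not> int p dvd Q"
    and "T a = 0" "\<not> int p * int p dvd T (a + Q)" "n mod Q = a mod Q"
  shows "nu (int p) (T n) = nu (int p) (n - a) + 1"
proof (cases "n = a")
  case True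
  then show ?thesis using assms(5) by (simp add: nu_def)
next
  case False
  have pr: "prime (int p)" using assms(1) by simp
  obtain z where z: "n - a = Q * z" using assms(7) by (metis mod_eq_dvd_iff dvdE)
  with False have "z \<noteq> 0" by auto
  then obtain w where w: "z = int p ^ multiplicity (int p) z * w" "\<not> int p dvd w"
    using pr by (metis multiplicity_decompose' not_prime_unit)
  define k where "k = multiplicity (int p) z"
  have zk: "z = int p ^ k * w" using w(1) by (simp add: k_def)
  obtain e where e: "T (a + Q) = int p * e"
    using assms(3,5) by (metis diff_zero dvdE trib_period_def)
  have "\<not> int p dvd e" using assms(6) e by auto
  have n: "n = a + w * (Q * int p ^ k)" using z zk by (simp add: algebra_simps)
  have "int p ^ (k + 2) dvd T n - w * int p ^ k * (int p * e)"
    using trib_lift_multiple[OF assms(3,2), of k a w] by (simp add: n assms(5) e)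
  then obtain t where "T n - w * int p ^ k * (int p * e) = int p ^ (k + 2) * t" by (elim dvdE)
  then have Tn: "T n = int p ^ (k + 1) * (w * e + int p * t)" by (simp add: algebra_simps)
  have "\<not> int p dvd w * e"
    using w(2) \<open>\<not> int p dvd e\<close> prime_dvd_mult_iff[OF pr] by blast
  then have nd: "\<not> int p dvd w * e + int p * t"
    by (simp add: dvd_add_left_iff)
  have p0: "int p \<noteq> 0" using pr by auto
  have "multiplicity (int p) (T n) = k + 1"
    by (rule multiplicity_eqI) (use nd p0 in \<open>simp_all add: Tn\<close>)
  moreover have "multiplicity (int p) (n - a) = k"
  proof (rule multiplicity_eqI)
    show "int p ^ k dvd n - a" by (simp add: z zk)
    have "\<not> int p dvd Q * w" using w(2) assms(4) prime_dvd_mult_iff[OF pr] by blast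
    then have "\<not> int p ^ k * int p dvd int p ^ k * (Q * w)" using p0 by simp
    then show "\<not> int p ^ Suc k dvd n - a" by (simp add: z zk algebra_simps)
  qed
  moreover have "T n \<noteq> 0" using Tn nd p0 by auto
  ultimately show ?thesis using False by (simp add: nu_def)
qed

lemma nu_eq_0:
  assumes "\<not> p dvd x"
  shows "nu p x = 0"
  using assms by (auto simp: nu_def not_dvd_imp_multiplicity_0 zero_ereal_def)

lemma nu_elsewhere:
  assumes "trib_period p Q" "\<And>i. 0 \<le> i \<Longrightarrow> i < Q \<Longrightarrow> p dvd T i \<Longrightarrow> \<exists>a\<in>A. i = a mod Q"
    and "Q > 0" "\<forall>a\<in>A. \<not> n mod Q = a mod Q"
  shows "nu p (T n) = 0"
proof (rule nu_eq_0)
  have "Q dvd n - n mod Q" by (simp add: mod_eq_dvd_iff[symmetric])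
  then have "p dvd T n - T (n mod Q)" by (rule trib_period_dvd_diff[OF assms(1)])
  moreover have "\<not> p dvd T (n mod Q)" using assms(2)[of "n mod Q"] assms(3,4) by auto
  ultimately show "\<not> p dvd T n" by (metis dvd_diff_right_iff)
qed

text \<open>\<open>nu p Q = 0\<close> makes the condition on \<open>a - i\<close> automatic, and all
  exceptional sets are empty.\<close>

lemma MLstmt_if_linear_on_classes:
  assumes "Q > 0" "nu p Q = 0"
    and lin: "\<And>n a. a \<in> A \<Longrightarrow> n mod Q = a mod Q \<Longrightarrow> nu p (T n) = nu p (n - a) + 1"
    and const: "\<And>n. \<forall>a\<in>A. \<not> n mod Q = a mod Q \<Longrightarrow> nu p (T n) = 0"
  shows "MLstmt p"
  unfolding MLstmt_def
proof (intro exI[of _ Q] conjI ballI assms(1))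
  fix i assume i: "i \<in> {0..<Q}"
  show "(\<exists>\<kappa>::nat. finite {n. n mod Q = i \<and> nu p (T n) \<noteq> ereal (real \<kappa>)})
    \<or> (\<exists>a \<kappa> \<mu>. \<mu> > 0 \<and> nu p (a - i) \<ge> nu p Q \<and> finite {n. n mod Q = i \<and>
         nu p (T n) \<noteq> ereal (real_of_int \<kappa>) + ereal (real_of_int \<mu>) * nu p (n - a)})"
  proof (cases "\<exists>a\<in>A. i = a mod Q")
    case True
    then obtain a where a: "a \<in> A" "i = a mod Q" by blast
    have "{n. n mod Q = i \<and> nu p (T n) \<noteq> ereal (real_of_int 1) + ereal (real_of_int 1) * nu p (n - a)} = {}"
      using lin[OF a(1)] a(2) by (auto simp: add.commute one_ereal_def[symmetric])
    then have "finite {n. n mod Q = i \<and>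
        nu p (T n) \<noteq> ereal (real_of_int 1) + ereal (real_of_int 1) * nu p (n - a)}" by (simp only: finite.emptyI)
    moreover have "nu p (a - i) \<ge> nu p Q" unfolding assms(2) by (simp add: nu_def)
    ultimately show ?thesis by (intro disjI2 exI[of _ a] exI[of _ 1]) simp
  next
    case False
    have "{n. n mod Q = i \<and> nu p (T n) \<noteq> ereal (real 0)} = {}"
      using const False by (auto simp: zero_ereal_def[symmetric])
    then have "finite {n. n mod Q = i \<and> nu p (T n) \<noteq> ereal (real 0)}" by (simp only: finite.emptyI)
    then show ?thesis by blast
  qed
qed

definition trib_zero_set :: "int set" where
  "trib_zero_set = {0, -1, -4, -17}"

text \<open>The indices \<open>Q - 1\<close>, \<open>Q - 4\<close>, \<open>Q - 17\<close> represent
  the negative zeros modulo \<open>Q\<close>; the last check, modulo \<open>p * p\<close>, says that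
  the zeros are simple.\<close>

fun valid_linear_case :: "int \<Rightarrow> int \<Rightarrow> bool" where
  "valid_linear_case p Q \<longleftrightarrow> unit_triple p (trib_mod p Q) \<and>
     list_all (\<lambda>i. fst (trib_mod p i) mod p = 0 \<longrightarrow> i \<in> {0, Q - 1, Q - 4, Q - 17}) [0..Q - 1] \<and>
     list_all (\<lambda>a. fst (trib_mod (p * p) (Q - a)) mod (p * p) \<noteq> 0) [0, 1, 4, 17]"

lemma valid_linear_cases: "valid_linear_case 83 287" "valid_linear_case 397 132"
  by code_simp+

declare valid_linear_case.simps [simp del]

lemma linear_case:
  assumes "valid_linear_case p Q" "prime p" "odd p" "17 < Q" "\<not> p dvd Q"
  shows "\<And>n a. a \<in> trib_zero_set \<Longrightarrow> n mod Q = a mod Q \<Longrightarrow> nu (p) (T n) = nu (p) (n - a) + 1"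
    and "\<And>n. \<forall>a\<in>trib_zero_set. \<not> n mod Q = a mod Q \<Longrightarrow> nu (p) (T n) = 0"
proof -
  have p1: "p > 1" using assms(2) by (rule prime_gt_1_int)
  define q where "q = nat p"
  then have q: "p = int q" using p1 by simp
  have per: "trib_period (p) Q"
    using assms(1,4) p1 unfolding valid_linear_case.simps by (intro trib_period_if_unit_triple) auto
  show "nu (p) (T n) = nu (p) (n - a) + 1"
    if a: "a \<in> trib_zero_set" "n mod Q = a mod Q" for n a
  proof (rule nu_at_zero_class[of q Q a n, folded q])
    show "prime q" "odd q" using assms(2,3) q by simp_all
    show "trib_period p Q" "\<not> p dvd Q" "n mod Q = a mod Q" by (fact per assms(5) a(2))+
    show "T a = 0" using a(1) trib_zeros by (auto simp: trib_zero_set_def)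
    have a': "a = 0 \<or> a = -1 \<or> a = -4 \<or> a = -17" using a(1) by (auto simp: trib_zero_set_def)
    obtain x y z where v: "trib_mod (p * p) (a + Q) = (x, y, z)" by (metis prod_cases3)
    have "fst (trib_mod (p * p) (a + Q)) mod (p * p) \<noteq> 0"
      using assms(1) a' unfolding valid_linear_case.simps list_all_iff
      by (elim disjE) (simp_all del: unit_triple.simps)
    then have "\<not> p * p dvd x" unfolding v by (simp add: mod_eq_0_iff_dvd)
    moreover have "p * p dvd T (a + Q) - x"
      using a' assms(4) by (intro trib_mod_correct(1)[OF _ v]) auto
    ultimately show "\<not> p * p dvd T (a + Q)"
      by (metis dvd_diff_right_iff)
  qed
  show "nu (p) (T n) = 0" if "\<forall>a\<in>trib_zero_set. \<not> n mod Q = a mod Q" for n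
  proof (rule nu_elsewhere[OF per _ _ that])
    fix i assume i: "0 \<le> i" "i < Q" "p dvd T i"
    obtain x y z where v: "trib_mod (p) i = (x, y, z)" by (metis prod_cases3)
    have "p dvd x"
      using trib_mod_correct(1)[OF i(1) v] i(3) by (metis dvd_diff_right_iff dvd_diff_commute)
    then have "i \<in> {0, Q - 1, Q - 4, Q - 17}"
      using assms(1) i v unfolding valid_linear_case.simps list_all_iff
      by (auto simp: mod_eq_0_iff_dvd simp del: unit_triple.simps)
    moreover have "(- k) mod Q = Q - k" if "0 < k" "k < Q" for k
      using that by (metis mod_add_self1 mod_pos_pos_trivial add_uminus_conv_diff diff_ge_0_iff_ge less_imp_le diff_less_eq less_add_same_cancel1)
    ultimately show "\<exists>a\<in>trib_zero_set. i = a mod Q"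
      using assms(4) by (auto simp: trib_zero_set_def)
  qed (use assms(4) in simp)
qed

lemma prime_83: "prime (83 :: int)" and prime_397: "prime (397 :: int)"
  by simp_all

lemma linear_case_83:
  "a \<in> trib_zero_set \<Longrightarrow> n mod 287 = a mod 287 \<Longrightarrow> nu 83 (T n) = nu 83 (n - a) + 1"
  "\<forall>a\<in>trib_zero_set. \<not> n mod 287 = a mod 287 \<Longrightarrow> nu 83 (T n) = 0"
  by (rule linear_case[OF valid_linear_cases(1) prime_83]; simp)+

lemma linear_case_397:
  "a \<in> trib_zero_set \<Longrightarrow> n mod 132 = a mod 132 \<Longrightarrow> nu 397 (T n) = nu 397 (n - a) + 1"
  "\<forall>a\<in>trib_zero_set. \<not> n mod 132 = a mod 132 \<Longrightarrow> nu 397 (T n) = 0"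
  by (rule linear_case[OF valid_linear_cases(2) prime_397]; simp)+

text \<open>In the formula for 397 the valuation is infinite only at \<open>n = b\<close> for one of
  the four zeros \<open>b\<close>.\<close>

theorem trib_eq_0_imp:
  assumes "T a = 0"
  shows "a \<in> trib_zero_set"
proof -
  have inf: "nu 397 (T a) = \<infinity>" using assms by (simp add: nu_def)
  then have "\<not> (\<forall>b\<in>trib_zero_set. \<not> a mod 132 = b mod 132)"
    using linear_case_397(2)[of a] by (auto simp: zero_ereal_def)
  then obtain b where b: "b \<in> trib_zero_set" "a mod 132 = b mod 132" by blast
  then have "nu 397 (a - b) + 1 = \<infinity>" using linear_case_397(1)[OF b] inf by simp
  then have "a = b" by (auto simp: nu_def one_ereal_def split: if_splits)
  then show ?thesis using b by simp
qed

section \<open>Primes with a non-integral zero\<close>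

text \<open>With \<open>Q = p ^ s * Q'\<close> and \<open>Q'\<close> prime to \<open>p\<close>, the
  zero stays simple for the period \<open>N' = Q' * N\<close>. Once it is known to order
  \<open>s + 2\<close>, further Newton steps are multiples of \<open>N' * p ^ (s + 1)\<close>, hence
  of both \<open>Q\<close> and \<open>p\<close>, so one class \<open>i\<close> serves every
  \<open>K\<close>.\<close>

lemma infinitely_many_divisible:
  assumes "prime p" "odd p" "N > 0" "trib_period (int p) N"
    and "int p * int p dvd T m" "\<not> int p * int p dvd T (m + N) - T m" "(Q :: int) > 0"
  shows "\<exists>i\<in>{0..<Q}. \<forall>K. infinite {n. n mod Q = i \<and> int p dvd n - m \<and> int p ^ K dvd T n}"
proof -
  have pr: "prime (int p)" using assms(1) by simp
  have p0: "int p > 0" using prime_gt_0_int[OF pr] .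
  define s where "s = multiplicity (int p) Q"
  obtain Q' where Q': "Q = int p ^ s * Q'" "\<not> int p dvd Q'"
    unfolding s_def using pr assms(7) by (metis multiplicity_decompose' not_prime_unit less_irrefl)
  have "Q' > 0" using Q'(1) assms(7) p0 by (metis zero_less_mult_pos zero_less_power)
  define N' where "N' = Q' * N"
  have "N' > 0" using \<open>Q' > 0\<close> assms(3) by (simp add: N'_def)
  have per: "trib_period (int p) N'"
    unfolding N'_def by (rule trib_period_mult[OF assms(4)])
  obtain e where e: "T (m + N) - T m = int p * e"
    using assms(4) by (auto simp: trib_period_def dvd_def)
  have "\<not> int p dvd e" using assms(6) e p0 by simp
  have incr: "\<not> int p * int p dvd T (m + N') - T m"
  proof
    assume "int p * int p dvd T (m + N') - T m"
    moreover have "int p * int p dvd T (m + N') - T m - Q' * (T (m + N) - T m)"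
      unfolding N'_def using p0 by (intro tribseq_first_order assms(4) tribseq_T_int) auto
    ultimately have "int p * int p dvd Q' * (T (m + N) - T m)"
      by (metis dvd_diff_right_iff)
    then have "int p dvd Q' * e" using p0 by (simp add: e mult.left_commute)
    then show False
      using Q'(2) \<open>\<not> int p dvd e\<close> prime_dvd_mult_iff[OF pr] by blast
  qed
  \<comment> \<open>Starting from \<open>p * p\<close> dividing \<open>T m\<close>, all corrections
    are multiples of \<open>p\<close>, which keeps \<open>m1\<close> congruent to \<open>m\<close>
    modulo \<open>p\<close>.\<close>
  have "\<exists>n. N' * int p ^ 1 dvd n - m \<and> int p ^ (Suc s + 1) dvd T n"
    using assms(5) by (intro trib_hensel[OF assms(1,2) per incr]) (simp_all add: power2_eq_square)
  then obtain m1 where m1: "N' * int p dvd m1 - m" "int p ^ (Suc s + 1) dvd T m1" by auto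
  have "infinite {n. n mod Q = m1 mod Q \<and> int p dvd n - m \<and> int p ^ K dvd T n}" for K
  proof -
    define k where "k = max K (Suc s)"
    have "N' dvd m1 - m" using m1(1) by (rule dvd_mult_left)
    then obtain n where n: "N' * int p ^ Suc s dvd n - m1" "int p ^ (k + 1) dvd T n"
      using trib_hensel[OF assms(1,2) per incr, of m1 "Suc s" k] m1(2) by (auto simp: k_def)
    define L where "L = N' * int p ^ k"
    have perL: "trib_period (int p ^ (k + 1)) L"
      unfolding L_def using trib_lift[OF per assms(2)] by blast
    \<comment> \<open>Adding multiples of a period modulo \<open>p ^ (k + 1)\<close> turns one
      solution into infinitely many.\<close>
    have "n + int t * L \<in> {n. n mod Q = m1 mod Q \<and> int p dvd n - m \<and> int p ^ K dvd T n}" for t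
    proof -
      define n' where "n' = n + int t * L"
      have "N' * int p ^ Suc s dvd L"
        unfolding L_def by (intro mult_dvd_mono le_imp_power_dvd) (auto simp: k_def)
      then have "N' * int p ^ Suc s dvd (n - m1) + int t * L"
        by (intro dvd_add n(1) dvd_mult)
      then have d: "N' * int p ^ Suc s dvd n' - m1" by (simp add: n'_def algebra_simps)
      have "Q dvd N' * int p ^ Suc s" by (simp add: Q'(1) N'_def algebra_simps)
      then have "Q dvd n' - m1" using d by (rule dvd_trans)
      then have 1: "n' mod Q = m1 mod Q" by (simp add: mod_eq_dvd_iff)
      have "int p dvd N' * int p ^ Suc s" by simp
      then have "int p dvd n' - m1" using d by (rule dvd_trans)
      moreover have "int p dvd m1 - m" using m1(1) by (rule dvd_mult_right)
      ultimately have "int p dvd (n' - m1) + (m1 - m)" by (rule dvd_add)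
      then have 2: "int p dvd n' - m" by simp
      have "int p ^ (k + 1) dvd T n' - T n"
        unfolding n'_def using trib_period_mult[OF perL] by (simp add: trib_period_def)
      from dvd_add[OF this n(2)] have "int p ^ (k + 1) dvd T n'" by simp
      moreover have "int p ^ K dvd int p ^ (k + 1)" by (rule le_imp_power_dvd) (simp add: k_def)
      ultimately have "int p ^ K dvd T n'" by (rule dvd_trans[rotated])
      with 1 2 show ?thesis unfolding n'_def by blast
    qed
    then have "range (\<lambda>t. n + int t * L) \<subseteq> {n. n mod Q = m1 mod Q \<and> int p dvd n - m \<and> int p ^ K dvd T n}"
      by blast
    moreover have "inj (\<lambda>t. n + int t * L)"
      using \<open>N' > 0\<close> p0 by (intro injI) (simp add: L_def)
    then have "infinite (range (\<lambda>t. n + int t * L))"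
      using finite_imageD by blast
    ultimately show ?thesis using infinite_super by blast
  qed
  moreover have "m1 mod Q \<in> {0..<Q}" using assms(7) by simp
  ultimately show ?thesis by blast
qed

lemma le_multiplicity_if_power_dvd:
  assumes "prime (p :: int)" "x \<noteq> 0" "p ^ k dvd x"
  shows "k \<le> multiplicity p x"
  using assms by (intro multiplicity_geI) auto

lemma power_dvd_if_nu_affine:
  assumes "prime (p :: int)" "nu p x = ereal (real_of_int \<kappa>) + ereal (real_of_int \<mu>) * nu p y"
    and "\<mu> > 0" "p ^ K dvd x" "int K \<ge> \<kappa> + \<mu> * int j"
  shows "p ^ j dvd y"
proof (cases "y = 0")
  case False
  define m where "m = multiplicity p y"
  have eq: "nu p x = ereal (real_of_int (\<kappa> + \<mu> * int m))"
    using assms(2) False by (simp add: nu_def m_def)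
  then have "x \<noteq> 0" by (auto simp: nu_def)
  with eq have "real (multiplicity p x) = real_of_int (\<kappa> + \<mu> * int m)" by (simp add: nu_def)
  then have "int (multiplicity p x) = \<kappa> + \<mu> * int m" by linarith
  moreover have "K \<le> multiplicity p x"
    using le_multiplicity_if_power_dvd[OF assms(1) \<open>x \<noteq> 0\<close> assms(4)] .
  ultimately have "\<mu> * int j \<le> \<mu> * int m" using assms(5) by linarith
  then have "j \<le> m" using assms(3) by simp
  then show ?thesis unfolding m_def by (rule multiplicity_dvd')
qed simp

text \<open>Unbounded valuations exclude the constant case. In the linear case they force
  \<open>n\<close> towards \<open>a\<close>, so \<open>T a = 0\<close> and \<open>a\<close> is
  congruent to \<open>m\<close> modulo \<open>p\<close>, against \<open>far\<close>.\<close>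

theorem not_MLstmt:
  assumes "prime p" "odd p" "N > 0" "trib_period (int p) N"
    and "int p * int p dvd T m" "\<not> int p * int p dvd T (m + N)"
    and far: "\<And>a. a \<in> trib_zero_set \<Longrightarrow> \<not> int p dvd m - a"
  shows "\<not> MLstmt (int p)"
proof
  assume "MLstmt (int p)"
  then obtain Q :: int where Q: "Q > 0" and cases: "\<And>i. i \<in> {0..<Q} \<Longrightarrow>
      (\<exists>\<kappa>::nat. finite {n::int. n mod Q = i \<and> nu (int p) (T n) \<noteq> ereal (real \<kappa>)})
    \<or> (\<exists>(a::int) (\<kappa>::int) (\<mu>::int). \<mu> > 0 \<and> nu (int p) (a - i) \<ge> nu (int p) Q \<and>
         finite {n::int. n mod Q = i \<and>
           nu (int p) (T n) \<noteq> ereal (real_of_int \<kappa>) + ereal (real_of_int \<mu>) * nu (int p) (n - a)})"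
    unfolding MLstmt_def by blast
  have pr: "prime (int p)" using assms(1) by simp
  have "\<not> int p * int p dvd T (m + N) - T m"
    using assms(5,6) by (metis dvd_diff_left_iff)
  then obtain i where i: "i \<in> {0..<Q}"
    and inf: "\<And>K. infinite {n. n mod Q = i \<and> int p dvd n - m \<and> int p ^ K dvd T n}"
    using infinitely_many_divisible[OF assms(1-5) _ Q] by blast
  \<comment> \<open>Finitely many exceptions cannot exhaust the infinitely many candidates.\<close>
  have pick: "\<exists>n. n mod Q = i \<and> int p dvd n - m \<and> int p ^ K dvd T n \<and> P n"
    if "finite {n. n mod Q = i \<and> \<not> P n}" for K P
  proof -
    have "infinite ({n. n mod Q = i \<and> int p dvd n - m \<and> int p ^ K dvd T n} - {n. n mod Q = i \<and> \<not> P n})"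
      using inf that by (simp add: Diff_infinite_finite)
    then obtain n where "n \<in> {n. n mod Q = i \<and> int p dvd n - m \<and> int p ^ K dvd T n}
        - {n. n mod Q = i \<and> \<not> P n}"
      using infinite_imp_nonempty by blast
    then show ?thesis by blast
  qed
  from cases[OF i] show False
  proof (elim disjE exE conjE)
    fix \<kappa> :: nat assume "finite {n. n mod Q = i \<and> nu (int p) (T n) \<noteq> ereal (real \<kappa>)}"
    from pick[OF this, of "Suc \<kappa>"] obtain n
      where n: "int p ^ Suc \<kappa> dvd T n" "nu (int p) (T n) = ereal (real \<kappa>)" by blast
    then have "T n \<noteq> 0" by (auto simp: nu_def)
    with n(2) have "multiplicity (int p) (T n) = \<kappa>" by (simp add: nu_def)
    with le_multiplicity_if_power_dvd[OF pr \<open>T n \<noteq> 0\<close> n(1)] show False by simp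
  next
    fix a \<kappa> \<mu> :: int assume mu: "\<mu> > 0" and fin: "finite {n. n mod Q = i \<and>
      nu (int p) (T n) \<noteq> ereal (real_of_int \<kappa>) + ereal (real_of_int \<mu>) * nu (int p) (n - a)}"
    have near: "\<exists>n. int p dvd n - m \<and> int p ^ j dvd n - a \<and> int p ^ j dvd T n" for j
    proof -
      \<comment> \<open>Large enough for the affine law to give \<open>p ^ j\<close> dividing
        \<open>n - a\<close>, and at least \<open>j\<close>.\<close>
      define K where "K = nat (\<bar>\<kappa>\<bar> + \<mu> * int j) + j"
      have "\<mu> * int j \<ge> 0" using mu by simp
      then have K: "int K \<ge> \<kappa> + \<mu> * int j" "j \<le> K" by (simp_all add: K_def)
      from pick[OF fin, of K] obtain n where n: "int p dvd n - m" "int p ^ K dvd T n"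
        "nu (int p) (T n) = ereal (real_of_int \<kappa>) + ereal (real_of_int \<mu>) * nu (int p) (n - a)"
        by blast
      have "int p ^ j dvd n - a"
        by (rule power_dvd_if_nu_affine[OF pr n(3) mu n(2) K(1)])
      moreover have "int p ^ j dvd T n"
        using n(2) le_imp_power_dvd[OF K(2)] by (rule dvd_trans[rotated])
      ultimately show ?thesis using n(1) by blast
    qed
    have "T a = 0"
    proof (rule trib_padic_integer_zero[OF assms(2)])
      show "p > 1" using assms(1) by (rule prime_gt_1_nat)
      show "nat N > 0" "trib_period (int p) (int (nat N))" using assms(3,4) by simp_all
    qed (use near in blast)
    then have "a \<in> trib_zero_set" by (rule trib_eq_0_imp)
    moreover obtain n where n: "int p dvd n - m" "int p dvd n - a" using near[of 1] by auto
    have "int p dvd m - a" using dvd_diff[OF n(2,1)] by simp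
    ultimately show False using far by blast
  qed
qed

text \<open>
  \<open>N\<close> is a period modulo \<open>p\<close>; the class of \<open>m\<close> contains a simple \<open>p\<close>-adic zero congruent to \<open>m\<close>
  modulo \<open>p\<close>, hence different from the four integer zeros.
\<close>

fun valid_certificate :: "int \<times> int \<times> int \<Rightarrow> bool" where
  "valid_certificate (p, N, m) \<longleftrightarrow> odd p \<and> N > 0 \<and> m \<ge> 0 \<and> unit_triple p (trib_mod p N) \<and>
     fst (trib_mod (p * p) m) mod (p * p) = 0 \<and> fst (trib_mod (p * p) (m + N)) mod (p * p) \<noteq> 0 \<and>
     m mod p \<noteq> 0 \<and> (m + 1) mod p \<noteq> 0 \<and> (m + 4) mod p \<noteq> 0 \<and> (m + 17) mod p \<noteq> 0"

lemma not_MLstmt_if_valid_certificate: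
  assumes "valid_certificate (p, N, m)" "prime p"
  shows "\<not> MLstmt p"
proof -
  have "p > 1" using assms(2) by (rule prime_gt_1_int)
  define q where "q = nat p"
  then have q: "p = int q" using \<open>p > 1\<close> by simp
  obtain x y z where v: "trib_mod (p * p) m = (x, y, z)" by (metis prod_cases3)
  obtain x' y' z' where v': "trib_mod (p * p) (m + N) = (x', y', z')" by (metis prod_cases3)
  have c: "N > 0" "m \<ge> 0" "unit_triple p (trib_mod p N)" "p * p dvd x" "\<not> p * p dvd x'" "odd p"
    "\<not> p dvd m - 0" "\<not> p dvd m - (-1)" "\<not> p dvd m - (-4)" "\<not> p dvd m - (-17)"
    using assms(1) v v' by (simp_all add: mod_eq_0_iff_dvd)
  show ?thesis
    unfolding q
  proof (rule not_MLstmt)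
    show "prime q" using assms(2) q by simp
    show "odd q" using c(6) q by simp
    show "N > 0" by (fact c(1))
    show "trib_period (int q) N"
      using c \<open>p > 1\<close> unfolding q[symmetric] by (intro trib_period_if_unit_triple) auto
    show "int q * int q dvd T m"
      using dvd_add[OF trib_mod_correct(1)[OF c(2) v] c(4)] by (simp add: q)
    have "p * p dvd T (m + N) - x'" using c(1,2) by (intro trib_mod_correct(1)[OF _ v']) simp
    then show "\<not> int q * int q dvd T (m + N)"
      using c(5) unfolding q[symmetric] by (metis dvd_diff_right_iff)
    show "\<not> int q dvd m - a" if "a \<in> trib_zero_set" for a
      using that c(7-10) unfolding q[symmetric] trib_zero_set_def by blast
  qed
qed

definition hensel_certificate_list :: "(int \<times> int \<times> int) list" where
  "hensel_certificate_list = [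
    (5, 31, 52), (7, 48, 85), (13, 168, 342), (17, 96, 1180), (19, 360, 302), (23, 553, 1807),
    (29, 140, 3997), (31, 331, 391), (37, 469, 872), (41, 560, 10675), (43, 308, 3854),
    (47, 46, 721), (53, 52, 917), (59, 3541, 2529), (61, 1860, 1448), (67, 1519, 2895),
    (71, 5113, 4223), (73, 5328, 5359), (79, 3120, 30459), (89, 8011, 1471), (97, 3169, 2171),
    (101, 680, 14466), (107, 1272, 14176), (109, 990, 7365), (113, 12883, 4978),
    (127, 5376, 20730), (131, 5720, 13389), (137, 18907, 42537), (139, 3864, 37311),
    (149, 7400, 136376), (151, 2850, 14951), (157, 8269, 41011), (167, 9296, 30495),
    (173, 2494, 20266), (179, 32221, 9923), (181, 10981, 30205), (191, 36673, 42256),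
    (193, 4656, 37835), (197, 3234, 27628), (199, 198, 10388), (211, 5565, 83018),
    (223, 16651, 41260), (227, 17176, 65983), (229, 17557, 33082), (233, 9048, 313314),
    (239, 4760, 4198), (241, 29040, 17648), (251, 63253, 50985), (257, 256, 5174),
    (263, 23056, 22249), (269, 268, 24029), (271, 73440, 31727), (277, 12788, 124121),
    (281, 13160, 45011), (283, 13348, 38819), (293, 28616, 74239), (307, 31416, 29634),
    (311, 310, 20273), (313, 32761, 63262), (317, 100807, 11561), (331, 36631, 34591),
    (337, 16224, 117101), (347, 40136, 145383), (349, 17400, 98274), (353, 124963, 112376),
    (359, 42960, 105548), (367, 45019, 82086), (373, 139128, 239601), (379, 48007, 4418),
    (383, 147073, 140811), (389, 151711, 402220), (401, 400, 53465), (409, 41820, 46381),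
    (419, 418, 58379), (421, 420, 18738), (431, 61920, 2623), (433, 62641, 458256),
    (439, 6424, 2864), (443, 196693, 23480), (449, 202051, 60136), (457, 34808, 733383),
    (461, 35420, 156099), (463, 71611, 139620), (467, 218557, 194172), (479, 76480, 82430),
    (487, 79219, 245210), (491, 10045, 4735), (499, 166, 55221), (503, 42168, 79790),
    (509, 259591, 32249), (521, 271963, 35698), (523, 273528, 597682), (541, 58536, 59169),
    (547, 149604, 221659), (557, 103416, 71480), (563, 52828, 122705), (569, 53960, 805810),
    (571, 40755, 1015485), (577, 111169, 119354), (587, 293, 114659), (593, 3256, 1482329),
    (599, 598, 119399)]"

text \<open>Trial division up to 23 suffices because 29 * 29 > 599; the condition
  \<open>d < p\<close> spares the small primes themselves.\<close>

lemma primes_covered: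
  "list_all (\<lambda>p. list_ex (\<lambda>d. d < p \<and> p mod d = 0) [2, 3, 5, 7, 11, 13, 17, 19, 23] \<or>
     p \<in> {11, 83, 103, 163, 397} \<or> p \<in> set (map fst hensel_certificate_list)) [5..599]"
  by code_simp

lemma certificates_valid: "list_all valid_certificate hensel_certificate_list"
  by code_simp

theorem theorem5:
  shows "(\<forall>p::int. prime p \<and> 5 \<le> p \<and> p \<le> 599 \<and> p \<notin> {11, 83, 103, 163, 397} \<longrightarrow> \<not> MLstmt p)
    \<and> (\<forall>(p::int) (Q::int). (p, Q) \<in> {(83, 287), (397, 132)} \<longrightarrow>
         MLstmt p \<and>
         (\<forall>n::int.
            (\<forall>a\<in>{0, -1, -4, -17}. n mod Q = a mod Q \<longrightarrow> nu p (T n) = nu p (n - a) + 1)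
          \<and> ((\<forall>a\<in>{0, -1, -4, -17}. \<not> n mod Q = a mod Q) \<longrightarrow> nu p (T n) = 0)))"
proof (intro conjI allI impI)
  fix p :: int
  assume p: "prime p \<and> 5 \<le> p \<and> p \<le> 599 \<and> p \<notin> {11, 83, 103, 163, 397}"
  then have pr: "prime p" by blast
  have "\<not> list_ex (\<lambda>d. d < p \<and> p mod d = 0) [2, 3, 5, 7, 11, 13, 17, 19, 23]"
  proof
    assume "list_ex (\<lambda>d. d < p \<and> p mod d = 0) [2, 3, 5, 7, 11, 13, 17, 19, 23]"
    then obtain d where d: "d \<in> set [2, 3, 5, 7, 11, 13, 17, 19, 23]" "d < p" "p mod d = 0"
      unfolding list_ex_iff by (elim bexE conjE)
    have "d > 1" using d(1) by auto
    have "\<forall>m. 0 \<le> m \<and> m dvd p \<longrightarrow> m = 1 \<or> m = p" using pr by (simp add: prime_int_iff)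
    then have "0 \<le> d \<and> d dvd p \<longrightarrow> d = 1 \<or> d = p" by (rule spec)
    then show False using d(2,3) \<open>d > 1\<close> by (simp add: mod_eq_0_iff_dvd)
  qed
  moreover have "p \<in> set [5..599]" using p unfolding set_upto atLeastAtMost_iff by blast
  note bspec[OF primes_covered[unfolded list_all_iff] this]
  ultimately have "p \<in> set (map fst hensel_certificate_list)" using p by (elim disjE) (simp_all only: simp_thms)
  then obtain N m where "(p, N, m) \<in> set hensel_certificate_list" by auto
  then have "valid_certificate (p, N, m)"
    using certificates_valid unfolding list_all_iff by blast
  then show "\<not> MLstmt p" using pr by (rule not_MLstmt_if_valid_certificate)
next
  fix p Q :: int
  assume pQ: "(p, Q) \<in> {(83, 287), (397, 132)}"
  have lin: "nu p (T n) = nu p (n - a) + 1" if "a \<in> trib_zero_set" "n mod Q = a mod Q" for n a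
    using pQ that linear_case_83(1) linear_case_397(1) by auto
  have const: "nu p (T n) = 0" if "\<forall>a\<in>trib_zero_set. \<not> n mod Q = a mod Q" for n
    using pQ that linear_case_83(2) linear_case_397(2) by auto
  have "nu p Q = 0" using pQ by (auto intro!: nu_eq_0)
  moreover have "Q > 0" using pQ by auto
  ultimately show "MLstmt p" using lin const by (intro MLstmt_if_linear_on_classes[of Q p trib_zero_set])
  fix n :: int
  show "\<forall>a\<in>{0, -1, -4, -17}. n mod Q = a mod Q \<longrightarrow> nu p (T n) = nu p (n - a) + 1"
    using lin by (simp add: trib_zero_set_def)
  show "nu p (T n) = 0" if "\<forall>a\<in>{0, -1, -4, -17}. \<not> n mod Q = a mod Q"
    using const that by (simp add: trib_zero_set_def)
qed

end
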